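(* Let $X$ be a subscheme of $\mathbb{P}^n$ and let $m\ge1$. Assume there exists $j\ge0$ such that $[\operatorname{gin}(I_X)]_{m+j}$ is a lex-segment and $\operatorname{adim}(X,m+j,m)>0$. Then $AV_{X,j}(m)=0$. In particular, if $\operatorname{gin}(I_X)$ is a lex-segment ideal, then $X$ does not admit any unexpected hypersurfaces (of any degree for any multiplicity).
   Context: $K$ is an infinite field and $R=K[x_0,\dots,x_n]$ has the lexicographic monomial order with $x_0>x_1>\cdots>x_n$. For a homogeneous ideal $I$, $\operatorname{gin}(I)$ is the generic initial ideal of $I$ with respect to this order (the initial ideal of $g\cdot I$ for a general linear change of variables $g$). A set $M$ of monomials of the same degree is a lex-segment if whenever $u,v$ are monomials of that degree with $u\ge v$ and $v\in M$, then $u\in M$; a vector subspace of $R$ is a lex-segment if it is spanned by such a set. A homogeneous ideal is a lex-segment ideal if each of its homogeneous components is a lex-segment. For a closed subscheme $X\subseteq\mathbb{P}^n$, $I_X\subseteq R$ is its saturated homogeneous ideal; $[\,\cdot\,]_t$ is the degree $t$ component. Let $P\in\mathbb{P}^n$ be a general point with ideal $I_P$. Set $\operatorname{adim}(X,t,m)=\dim[I_X\cap I_P^m]_t$, $\operatorname{vdim}(X,t,m)=\dim[I_X]_t-\binom{m+n-1}{n}$, $\operatorname{edim}(X,t,m)=\max\{0,\operatorname{vdim}(X,t,m)\}$. For $j\ge0$, $m\ge1$, $AV_{X,j}(m)=\operatorname{adim}(X,m+j,m)-\operatorname{vdim}(X,m+j,m)$. $X$ admits an unexpected hypersurface of degree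 $t$ for multiplicity $m$ if $\operatorname{adim}(X,t,m)>\operatorname{edim}(X,t,m)$ (which forces $t\ge m$). *)

theory Defs
  imports "HOL-Analysis.Analysis" "HOL-Library.Poly_Mapping"
begin

section \<open>The polynomial ring\<close>

text \<open>
  Monomials are exponent vectors of type \<open>'v \<Rightarrow>\<^sub>0 nat\<close>. For \<open>R = K[x\<^sub>0,\<dots>,x\<^sub>n]\<close> the index type
  \<open>'v\<close> is finite and linearly ordered with \<open>n + 1\<close> elements, and \<open>i < j\<close> corresponds to
  \<open>x\<^sub>i > x\<^sub>j\<close>. With this convention the order on \<open>'v \<Rightarrow>\<^sub>0 nat\<close> provided by the library
  (\<open>u < v\<close> iff \<open>u\<close> has the smaller exponent at the smallest index where they differ) is
  the lexicographic monomial order with \<open>x\<^sub>0 > x\<^sub>1 > \<dots> > x\<^sub>n\<close>.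
\<close>

type_synonym ('v, 'k) mpoly = "('v \<Rightarrow>\<^sub>0 nat) \<Rightarrow>\<^sub>0 'k"

definition const :: "'k::comm_ring_1 \<Rightarrow> ('v, 'k) mpoly" where
  "const c = Poly_Mapping.single 0 c"

definition mono_poly :: "('v \<Rightarrow>\<^sub>0 nat) \<Rightarrow> ('v, 'k::comm_ring_1) mpoly" where
  "mono_poly u = Poly_Mapping.single u 1"

definition xvar :: "'v \<Rightarrow> ('v, 'k::comm_ring_1) mpoly" where
  "xvar i = mono_poly (Poly_Mapping.single i 1)"

text \<open>The value of a polynomial at \<open>\<sigma>\<close>, its coefficients being mapped by \<open>c\<close>.\<close>

definition subst ::
    "('k::comm_ring_1 \<Rightarrow> 'r::comm_ring_1) \<Rightarrow> ('v \<Rightarrow> 'r) \<Rightarrow> ('v, 'k) mpoly \<Rightarrow> 'r" where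
  "subst c \<sigma> f =
     (\<Sum>u \<in> Poly_Mapping.keys f. c (Poly_Mapping.lookup f u) * (\<Prod>i \<in> Poly_Mapping.keys u. \<sigma> i ^ Poly_Mapping.lookup u i))"

definition peval :: "('v \<Rightarrow> 'k::comm_ring_1) \<Rightarrow> ('v, 'k) mpoly \<Rightarrow> 'k" where
  "peval a f = subst (\<lambda>c. c) a f"

definition mdeg :: "('v \<Rightarrow>\<^sub>0 nat) \<Rightarrow> nat" where
  "mdeg u = (\<Sum>i \<in> Poly_Mapping.keys u. Poly_Mapping.lookup u i)"

definition homogeneous :: "nat \<Rightarrow> ('v, 'k::comm_ring_1) mpoly \<Rightarrow> bool" where
  "homogeneous d f \<longleftrightarrow> (\<forall>u \<in> Poly_Mapping.keys f. mdeg u = d)"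

section \<open>Vector subspaces and ideals\<close>

definition scale :: "'k::field \<Rightarrow> ('v, 'k) mpoly \<Rightarrow> ('v, 'k) mpoly" where
  "scale c f = const c * f"

definition kspan :: "('v, 'k::field) mpoly set \<Rightarrow> ('v, 'k) mpoly set" where
  "kspan B = module.span scale B"

definition kdim :: "('v, 'k::field) mpoly set \<Rightarrow> nat" where
  "kdim V = vector_space.dim scale V"

text \<open>Ideals are the submodules of the ring regarded as a module over itself.\<close>

definition is_ideal :: "'r::comm_ring_1 set \<Rightarrow> bool" where
  "is_ideal I \<longleftrightarrow> module.subspace ((*) :: 'r \<Rightarrow> 'r \<Rightarrow> 'r) I"

definition ideal_gen :: "'r::comm_ring_1 set \<Rightarrow> 'r set" where
  "ideal_gen B = module.span ((*) :: 'r \<Rightarrow> 'r \<Rightarrow> 'r) B"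

fun ideal_power :: "'r::comm_ring_1 set \<Rightarrow> nat \<Rightarrow> 'r set" where
  "ideal_power I 0 = UNIV"
| "ideal_power I (Suc m) = ideal_gen {f * g | f g. f \<in> I \<and> g \<in> ideal_power I m}"

definition homogeneous_ideal :: "('v, 'k::field) mpoly set \<Rightarrow> bool" where
  "homogeneous_ideal I \<longleftrightarrow>
     is_ideal I \<and> I = ideal_gen {f \<in> I. \<exists>d. homogeneous d f}"

text \<open>The degree \<open>t\<close> component of a homogeneous ideal.\<close>

definition component :: "('v, 'k::field) mpoly set \<Rightarrow> nat \<Rightarrow> ('v, 'k) mpoly set" where
  "component I t = {f \<in> I. homogeneous t f}"

definition irrelevant_ideal :: "('v, 'k::field) mpoly set" where
  "irrelevant_ideal = ideal_gen (range xvar)"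

definition saturated :: "('v, 'k::field) mpoly set \<Rightarrow> bool" where
  "saturated I \<longleftrightarrow>
     (\<forall>f. (\<exists>N. \<forall>h \<in> ideal_power irrelevant_ideal N. h * f \<in> I) \<longrightarrow> f \<in> I)"

text \<open>
  A closed subscheme of projective space is given by its saturated homogeneous ideal; this
  is a bijection (the unit ideal belongs to the empty subscheme, the zero ideal to the
  whole space).
\<close>

definition subscheme_ideal :: "('v, 'k::field) mpoly set \<Rightarrow> bool" where
  "subscheme_ideal I \<longleftrightarrow> homogeneous_ideal I \<and> saturated I"

section \<open>General linear changes of variables and general points\<close>

text \<open>
  A property holds for a general \<open>g\<close> (a general point \<open>P\<close>) if it holds on a nonempty
  Zariski open subset of \<open>GL\<^sub>n\<^sub>+\<^sub>1(K)\<close> (of \<open>\<bbbP>\<^sup>n(K)\<close>).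
\<close>

definition zariski_open_GL :: "('k::field ^ 'v::finite ^ 'v) set \<Rightarrow> bool" where
  "zariski_open_GL U \<longleftrightarrow>
     (\<exists>S :: ('v \<times> 'v, 'k) mpoly set.
        U = {g. invertible g \<and> (\<exists>F \<in> S. peval (\<lambda>(i, j). g $ i $ j) F \<noteq> 0)})"

definition for_general_change :: "('k::field ^ 'v::finite ^ 'v \<Rightarrow> bool) \<Rightarrow> bool" where
  "for_general_change Q \<longleftrightarrow> (\<exists>U. zariski_open_GL U \<and> U \<noteq> {} \<and> (\<forall>g \<in> U. Q g))"

text \<open>
  Points of projective space are represented by nonzero coordinate vectors; the open sets
  below are cut out by forms and hence invariant under rescaling.
\<close>

definition zariski_open_proj :: "('k::field ^ 'v::finite) set \<Rightarrow> bool" where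
  "zariski_open_proj U \<longleftrightarrow>
     (\<exists>S :: ('v, 'k) mpoly set. (\<forall>F \<in> S. \<exists>d. homogeneous d F) \<and>
        U = {a. a \<noteq> 0 \<and> (\<exists>F \<in> S. peval (($) a) F \<noteq> 0)})"

definition for_general_point :: "('k::field ^ 'v::finite \<Rightarrow> bool) \<Rightarrow> bool" where
  "for_general_point Q \<longleftrightarrow> (\<exists>U. zariski_open_proj U \<and> U \<noteq> {} \<and> (\<forall>a \<in> U. Q a))"

section \<open>Generic initial ideals\<close>

definition lead_monomial ::
    "('v::linorder, 'k::field) mpoly \<Rightarrow> ('v \<Rightarrow>\<^sub>0 nat)" where
  "lead_monomial f = Max (Poly_Mapping.keys f)"

definition initial_ideal ::
    "('v::linorder, 'k::field) mpoly set \<Rightarrow> ('v, 'k) mpoly set" where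
  "initial_ideal I = ideal_gen {mono_poly (lead_monomial f) | f. f \<in> I \<and> f \<noteq> 0}"

definition change_vars ::
    "'k::field ^ 'v::finite ^ 'v \<Rightarrow> ('v, 'k) mpoly \<Rightarrow> ('v, 'k) mpoly" where
  "change_vars g f = subst const (\<lambda>i. \<Sum>j \<in> UNIV. const (g $ i $ j) * xvar j) f"

definition gin ::
    "('v::{finite, linorder}, 'k::field) mpoly set \<Rightarrow> ('v, 'k) mpoly set" where
  "gin I = (THE J. for_general_change (\<lambda>g. initial_ideal (change_vars g ` I) = J))"

section \<open>Lex-segments\<close>

definition lex_segment_monomials :: "nat \<Rightarrow> ('v::linorder \<Rightarrow>\<^sub>0 nat) set \<Rightarrow> bool" where
  "lex_segment_monomials t M \<longleftrightarrow>
     (\<forall>u \<in> M. mdeg u = t) \<and>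
     (\<forall>u v. mdeg u = t \<longrightarrow> mdeg v = t \<longrightarrow> u \<ge> v \<longrightarrow> v \<in> M \<longrightarrow> u \<in> M)"

definition lex_segment :: "('v::linorder, 'k::field) mpoly set \<Rightarrow> bool" where
  "lex_segment V \<longleftrightarrow> (\<exists>t M. lex_segment_monomials t M \<and> V = kspan (mono_poly ` M))"

definition lex_segment_ideal :: "('v::linorder, 'k::field) mpoly set \<Rightarrow> bool" where
  "lex_segment_ideal I \<longleftrightarrow> homogeneous_ideal I \<and> (\<forall>t. lex_segment (component I t))"

section \<open>Actual, virtual and expected dimension\<close>

definition point_ideal :: "'k::field ^ 'v::finite \<Rightarrow> ('v, 'k) mpoly set" where
  "point_ideal a = ideal_gen {f. (\<exists>d. homogeneous d f) \<and> peval (($) a) f = 0}"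

definition adim :: "('v::finite, 'k::field) mpoly set \<Rightarrow> nat \<Rightarrow> nat \<Rightarrow> nat" where
  "adim I t m =
     (THE d. for_general_point
        (\<lambda>a :: 'k ^ 'v. kdim (component (I \<inter> ideal_power (point_ideal a) m) t) = d))"

text \<open>Below, \<open>n\<close> is the dimension of the projective space, and \<open>m \<ge> 1\<close>.\<close>

definition vdim :: "nat \<Rightarrow> ('v::finite, 'k::field) mpoly set \<Rightarrow> nat \<Rightarrow> nat \<Rightarrow> int" where
  "vdim n I t m = int (kdim (component I t)) - int ((m + n - 1) choose n)"

definition edim :: "nat \<Rightarrow> ('v::finite, 'k::field) mpoly set \<Rightarrow> nat \<Rightarrow> nat \<Rightarrow> int" where
  "edim n I t m = max 0 (vdim n I t m)"

definition AV :: "nat \<Rightarrow> ('v::finite, 'k::field) mpoly set \<Rightarrow> nat \<Rightarrow> nat \<Rightarrow> int" where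
  "AV n I j m = int (adim I (m + j) m) - vdim n I (m + j) m"

definition admits_unexpected ::
    "nat \<Rightarrow> ('v::finite, 'k::field) mpoly set \<Rightarrow> nat \<Rightarrow> nat \<Rightarrow> bool" where
  "admits_unexpected n I t m \<longleftrightarrow> int (adim I t m) > edim n I t m"

end

theory Submission
  imports Defs "HOL-Computational_Algebra.Polynomial"
begin

text \<open>
  Write \<open>x\<^sub>0\<close> for the largest variable and call the degree of a monomial in the other variables
  its tail degree. Forms of degree \<open>t\<close> vanishing to order \<open>m\<close> at \<open>(1 : 0 : \<dots> : 0)\<close> are those
  whose monomials all have tail degree at least \<open>m\<close>. Among monomials of a fixed degree the
  lexicographically largest one has the least tail degree, so this condition concerns the
  leading monomial only. A subspace of forms has as many leading monomials as its dimension
  (\<open>kdim_eq_card_lead_set\<close>). Moving a general point to \<open>(1 : 0 : \<dots> : 0)\<close> by a general change of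
  variables therefore gives (\<open>adim_eq\<close>): \<open>adim(X,t,m)\<close> is the number of monomials of degree
  \<open>t\<close> and tail degree at least \<open>m\<close> in the generic initial ideal.

  Now let the degree \<open>m + j\<close> part of the generic initial ideal be a lex-segment and
  \<open>adim(X,m+j,m) > 0\<close>. Then that part contains a monomial of tail degree at least \<open>m\<close>, hence every
  monomial of smaller tail degree, since those are lexicographically larger. There are
  \<open>m + n - 1\<close> choose \<open>n\<close> of them (\<open>card_monomials_tail_deg_less\<close>), so \<open>adim\<close> equals \<open>vdim\<close>
  (\<open>AV_eq_0\<close>). If instead \<open>adim\<close> is zero there is nothing unexpected, and this covers all
  degrees below \<open>m\<close>.

  Most of the work lies in showing that the generic initial ideal and the generic dimension
  exist. Over an infinite field two polynomial functions that are not identically zero have a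
  common point of nonvanishing, because on a line they become polynomials in one variable
  (\<open>polyfun_common_nonzero\<close>); this makes generic values unique. For
  existence in one degree, the number of leading monomials above a given one can only go up
  in a neighbourhood of a matrix (\<open>generic_card_lead_set_ge\<close>), so a matrix maximizing these
  numbers shows the generic behaviour. Dickson's lemma then reduces all degrees to finitely
  many (\<open>generic_lead_set\<close>). Finally, a condition on a general matrix is turned into one on
  its first column, a general point, in \<open>for_general_pointI\<close>.
\<close>

section \<open>Substitution homomorphisms\<close>

text \<open>Homomorphisms of commutative rings with unit.\<close>

locale rhom =
  fixes h :: "'a::comm_ring_1 \<Rightarrow> 'b::comm_ring_1"
  assumes one: "h 1 = 1"
    and add: "h (x + y) = h x + h y"
    and mult: "h (x * y) = h x * h y"
begin

lemma zero: "h 0 = 0"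
  using add[of 0 0] by simp

lemma sum: "h (sum f A) = (\<Sum>i\<in>A. h (f i))"
  by (induction A rule: infinite_finite_induct) (auto simp: zero add)

lemma prod: "h (prod f A) = (\<Prod>i\<in>A. h (f i))"
  by (induction A rule: infinite_finite_induct) (auto simp: one mult)

lemma power: "h (x ^ k) = h x ^ k"
  by (induction k) (auto simp: one mult)

end

text \<open>The value of a monomial; all variables may be used because exponents default to zero.\<close>

definition monom_value :: "('v::finite \<Rightarrow> 'r::comm_ring_1) \<Rightarrow> ('v \<Rightarrow>\<^sub>0 nat) \<Rightarrow> 'r" where
  "monom_value \<sigma> u = (\<Prod>i\<in>UNIV. \<sigma> i ^ Poly_Mapping.lookup u i)"

lemma monom_value_keys:
  "(\<Prod>i \<in> Poly_Mapping.keys u. \<sigma> i ^ Poly_Mapping.lookup u i) = monom_value \<sigma> u"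
  unfolding monom_value_def
  by (rule prod.mono_neutral_left) (auto simp: in_keys_iff)

lemma monom_value_add: "monom_value \<sigma> (u + w) = monom_value \<sigma> u * monom_value \<sigma> w"
  by (simp add: monom_value_def lookup_add power_add prod.distrib)

lemma monom_value_zero [simp]: "monom_value \<sigma> 0 = 1"
  by (simp add: monom_value_def)

lemma monom_value_single [simp]: "monom_value \<sigma> (Poly_Mapping.single i 1) = \<sigma> i"
proof -
  have "monom_value \<sigma> (Poly_Mapping.single i 1) = (\<Prod>j\<in>UNIV. if j = i then \<sigma> j else 1)"
    unfolding monom_value_def by (rule prod.cong) (auto simp: lookup_single when_def)
  then show ?thesis by simp
qed

lemma poly_mapping_decompose:
  "f = (\<Sum>u\<in>Poly_Mapping.keys f. Poly_Mapping.single u (Poly_Mapping.lookup f u))"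
  by (rule poly_mapping_eqI)
     (auto simp: lookup_sum lookup_single when_def in_keys_iff sum.delta')

lemma mpoly_induct [case_names zero add]:
  fixes f :: "'a \<Rightarrow>\<^sub>0 'b::comm_monoid_add"
  assumes "P 0" and "\<And>u c f. P f \<Longrightarrow> P (Poly_Mapping.single u c + f)"
  shows "P f"
proof -
  have "P (\<Sum>u\<in>A. Poly_Mapping.single u (Poly_Mapping.lookup f u))" if "finite A" for A
    using that by induction (auto intro: assms)
  then show ?thesis
    by (subst poly_mapping_decompose) simp
qed

lemma subst_superset:
  fixes c :: "'k::comm_ring_1 \<Rightarrow> 'r::comm_ring_1"
  assumes "c 0 = 0" and "finite A" and "Poly_Mapping.keys f \<subseteq> A"
  shows "subst c \<sigma> f = (\<Sum>u\<in>A. c (Poly_Mapping.lookup f u) * monom_value \<sigma> u)"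
  unfolding subst_def monom_value_keys
  by (rule sum.mono_neutral_left) (use assms in \<open>auto simp: in_keys_iff\<close>)

lemma subst_single:
  assumes "rhom c"
  shows "subst c \<sigma> (Poly_Mapping.single u x) = c x * monom_value \<sigma> u"
proof -
  interpret rhom c by fact
  show ?thesis
    by (subst subst_superset[of _ "{u}"]) (auto simp: zero)
qed

lemma subst_add:
  fixes c :: "'k::comm_ring_1 \<Rightarrow> 'r::comm_ring_1" and \<sigma> :: "'v::finite \<Rightarrow> 'r"
  assumes "rhom c"
  shows "subst c \<sigma> (f + g) = subst c \<sigma> f + subst c \<sigma> g"
proof -
  interpret rhom c by fact
  let ?A = "Poly_Mapping.keys f \<union> Poly_Mapping.keys g"
  have "Poly_Mapping.keys (f + g) \<subseteq> ?A" by (rule keys_add)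
  then show ?thesis
    by (simp add: subst_superset[of c ?A] zero lookup_add add distrib_right sum.distrib)
qed

lemma subst_mult:
  fixes c :: "'k::comm_ring_1 \<Rightarrow> 'r::comm_ring_1" and \<sigma> :: "'v::finite \<Rightarrow> 'r"
  assumes "rhom c"
  shows "subst c \<sigma> (f * g) = subst c \<sigma> f * subst c \<sigma> g"
proof -
  interpret rhom c by fact
  have z: "subst c \<sigma> 0 = 0" by (simp add: subst_def)
  have s: "subst c \<sigma> (Poly_Mapping.single u x * g) = subst c \<sigma> (Poly_Mapping.single u x) * subst c \<sigma> g"
    for u x
  proof (induction g rule: mpoly_induct)
    case (add w y g)
    then show ?case
      by (simp add: distrib_left mult_single subst_add[OF assms] subst_single[OF assms]
          mult monom_value_add algebra_simps)
  qed (simp add: z)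
  show ?thesis
    by (induction f rule: mpoly_induct)
       (simp_all add: z distrib_right subst_add[OF assms] s)
qed

lemma rhom_id: "rhom (\<lambda>x. x)"
  by unfold_locales auto

lemma rhom_const: "rhom const"
  by unfold_locales (auto simp: const_def single_add mult_single)

lemma rhom_subst:
  fixes c :: "'k::comm_ring_1 \<Rightarrow> 'r::comm_ring_1" and \<sigma> :: "'v::finite \<Rightarrow> 'r"
  assumes "rhom c" shows "rhom (subst c \<sigma>)"
proof
  interpret rhom c by fact
  show "subst c \<sigma> 1 = 1"
    using subst_single[OF assms, of \<sigma> 0 1] by (simp add: one)
qed (use assms in \<open>simp_all add: subst_add subst_mult\<close>)

lemma rhom_peval: "rhom (peval (a :: 'v::finite \<Rightarrow> 'k::comm_ring_1))"
  unfolding peval_def[abs_def] by (rule rhom_subst[OF rhom_id])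

lemma rhom_change_vars: "rhom (change_vars g)"
  unfolding change_vars_def[abs_def] by (rule rhom_subst[OF rhom_const])

lemmas peval_add = rhom.add[OF rhom_peval]
  and peval_mult = rhom.mult[OF rhom_peval]
  and peval_zero = rhom.zero[OF rhom_peval]
  and change_vars_add = rhom.add[OF rhom_change_vars]
  and change_vars_mult = rhom.mult[OF rhom_change_vars]
  and change_vars_zero = rhom.zero[OF rhom_change_vars]

lemma peval_const [simp]: "peval (a :: 'v::finite \<Rightarrow> 'k::comm_ring_1) (const x) = x"
  by (simp add: peval_def const_def subst_single[OF rhom_id])

lemma peval_xvar [simp]: "peval (a :: 'v::finite \<Rightarrow> 'k::comm_ring_1) (xvar i) = a i"
  unfolding peval_def xvar_def mono_poly_def
  by (simp only: subst_single[OF rhom_id] monom_value_single) simp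

lemma rhom_subst_compose:
  assumes "rhom h"
  shows "h (subst c \<sigma> f) = subst (\<lambda>x. h (c x)) (\<lambda>i. h (\<sigma> i)) f"
proof -
  interpret rhom h by fact
  show ?thesis by (simp add: subst_def sum mult prod power)
qed

lemma subst_const_xvar:
  fixes f :: "('a::finite, 'b::comm_ring_1) mpoly"
  shows "subst const xvar f = f"
proof -
  have m: "monom_value xvar u = (mono_poly u :: ('a, 'b) mpoly)" for u :: "'a \<Rightarrow>\<^sub>0 nat"
  proof (induction u rule: mpoly_induct)
    case (add i e u)
    have "monom_value xvar (Poly_Mapping.single i e) = (mono_poly (Poly_Mapping.single i e) :: ('a, 'b) mpoly)"
    proof (induction e)
      case 0
      then show ?case by (simp add: mono_poly_def)
    next
      case (Suc e)
      have "Poly_Mapping.single i (Suc e) = Poly_Mapping.single i 1 + Poly_Mapping.single i e"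
        by (simp add: single_add[symmetric])
      then show ?case
        using Suc by (simp only: monom_value_add monom_value_single) (simp add: xvar_def mono_poly_def mult_single)
    qed
    then show ?case
      using add by (simp add: monom_value_add mono_poly_def mult_single)
  qed (simp add: mono_poly_def)
  have "subst const xvar f = (\<Sum>u\<in>Poly_Mapping.keys f. Poly_Mapping.single u (Poly_Mapping.lookup f u))"
    unfolding subst_def monom_value_keys m
    by (rule sum.cong) (auto simp: const_def mono_poly_def mult_single)
  then show ?thesis
    using poly_mapping_decompose[of f] by simp
qed

lemma change_vars_const [simp]: "change_vars g (const x) = const x"
  by (simp add: change_vars_def const_def subst_single[OF rhom_const])

lemma change_vars_xvar:
  "change_vars g (xvar i) = (\<Sum>j \<in> UNIV. const (g $ i $ j) * xvar j)"
  unfolding change_vars_def xvar_def mono_poly_def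
  by (simp only: subst_single[OF rhom_const] monom_value_single)
     (simp add: const_def)

lemma change_vars_mat_1 [simp]:
  fixes f :: "('b::finite, 'a::field) mpoly"
  shows "change_vars (mat 1) f = f"
proof -
  have "(\<Sum>j\<in>UNIV. const ((mat 1 :: 'a ^ 'b ^ 'b) $ i $ j) * xvar j) = xvar i" for i
  proof -
    have "(\<Sum>j\<in>UNIV. const ((mat 1 :: 'a ^ 'b ^ 'b) $ i $ j) * xvar j) =
          (\<Sum>j\<in>UNIV. if j = i then xvar j else 0)"
      by (rule sum.cong) (auto simp: mat_def const_def)
    then show ?thesis by simp
  qed
  then show ?thesis
    by (simp add: change_vars_def subst_const_xvar)
qed

lemma change_vars_compose: "change_vars g (change_vars h f) = change_vars (h ** g) f"
proof -
  have "change_vars g (\<Sum>j\<in>UNIV. const (h $ i $ j) * xvar j) =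
        (\<Sum>k\<in>UNIV. const ((h ** g) $ i $ k) * xvar k)" for i
  proof -
    have "change_vars g (\<Sum>j\<in>UNIV. const (h $ i $ j) * xvar j) =
          (\<Sum>j\<in>UNIV. \<Sum>k\<in>UNIV. const (h $ i $ j * g $ j $ k) * xvar k)"
      by (simp add: rhom.sum[OF rhom_change_vars] change_vars_mult change_vars_xvar
          sum_distrib_left rhom.mult[OF rhom_const] mult.assoc)
    also have "\<dots> = (\<Sum>k\<in>UNIV. \<Sum>j\<in>UNIV. const (h $ i $ j * g $ j $ k) * xvar k)"
      by (rule sum.swap)
    finally show ?thesis
      by (simp add: matrix_matrix_mult_def rhom.sum[OF rhom_const] sum_distrib_right)
  qed
  then show ?thesis
    unfolding change_vars_def[of h] change_vars_def[of "h ** g"]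
    by (simp add: rhom_subst_compose[OF rhom_change_vars])
qed

lemma peval_change_vars: "peval (($) a) (change_vars g f) = peval (($) (g *v a)) f"
proof -
  have "(\<lambda>i. \<Sum>j\<in>UNIV. g $ i $ j * a $ j) = ($) (g *v a)"
    by (simp add: matrix_vector_mult_def fun_eq_iff)
  then show ?thesis
    unfolding change_vars_def peval_def[of "($) (g *v a)"]
    by (simp add: rhom_subst_compose[OF rhom_peval] rhom.sum[OF rhom_peval] peval_mult)
qed

lemma change_vars_inverse:
  assumes "invertible g"
  obtains h where "invertible h" "g ** h = mat 1" "h ** g = mat 1"
    "\<And>f. change_vars g (change_vars h f) = f" "\<And>f. change_vars h (change_vars g f) = f"
proof -
  obtain h where h: "g ** h = mat 1" "h ** g = mat 1"
    using assms by (auto simp: invertible_def)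
  then have "invertible h" by (auto simp: invertible_def)
  with h show ?thesis by (intro that) (auto simp: change_vars_compose)
qed

lemma bij_change_vars:
  assumes "invertible g" shows "bij (change_vars g)"
proof -
  obtain h where h: "g ** h = mat 1" "h ** g = mat 1"
    using assms by (auto simp: invertible_def)
  show ?thesis
    by (rule o_bij[of "change_vars h"]) (simp_all add: fun_eq_iff change_vars_compose h)
qed

section \<open>Polynomial functions and generic matrices\<close>

text \<open>
  A function on a set of parameters is polynomial with respect to a coordinate system \<open>e\<close> if it
  is the evaluation of a polynomial at the coordinates. For matrices the coordinates are the
  entries, for points the homogeneous coordinates.
\<close>

definition polyfun :: "('x \<Rightarrow> 'i::finite \<Rightarrow> 'k::comm_ring_1) \<Rightarrow> ('x \<Rightarrow> 'k) \<Rightarrow> bool" where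
  "polyfun e \<phi> \<longleftrightarrow> (\<exists>F. \<forall>x. \<phi> x = peval (e x) F)"

lemma polyfun_peval: "polyfun e (\<lambda>x. peval (e x) F)"
  by (auto simp: polyfun_def)

lemma polyfun_const [intro]: "polyfun e (\<lambda>x. c)"
  unfolding polyfun_def by (rule exI[of _ "const c"]) simp

lemma polyfun_coord: "polyfun e (\<lambda>x. e x i)"
  unfolding polyfun_def by (rule exI[of _ "xvar i"]) simp

lemma polyfun_add [intro]: "polyfun e \<phi> \<Longrightarrow> polyfun e \<psi> \<Longrightarrow> polyfun e (\<lambda>x. \<phi> x + \<psi> x)"
  unfolding polyfun_def by (metis peval_add)

lemma polyfun_mult [intro]: "polyfun e \<phi> \<Longrightarrow> polyfun e \<psi> \<Longrightarrow> polyfun e (\<lambda>x. \<phi> x * \<psi> x)"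
  unfolding polyfun_def by (metis peval_mult)

lemma polyfun_diff [intro]:
  assumes "polyfun e \<phi>" "polyfun e \<psi>" shows "polyfun e (\<lambda>x. \<phi> x - \<psi> x)"
proof -
  have "polyfun e (\<lambda>x. \<phi> x + (- 1) * \<psi> x)"
    by (intro polyfun_add polyfun_mult polyfun_const assms)
  then show ?thesis by simp
qed

lemma polyfun_sum [intro]:
  "(\<And>i. i \<in> A \<Longrightarrow> polyfun e (\<phi> i)) \<Longrightarrow> polyfun e (\<lambda>x. \<Sum>i\<in>A. \<phi> i x)"
  by (induction A rule: infinite_finite_induct) auto

lemma polyfun_prod [intro]:
  "(\<And>i. i \<in> A \<Longrightarrow> polyfun e (\<phi> i)) \<Longrightarrow> polyfun e (\<lambda>x. \<Prod>i\<in>A. \<phi> i x)"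
  by (induction A rule: infinite_finite_induct) auto

text \<open>Restricted to a line, a polynomial function is a polynomial in one variable.\<close>

lemma peval_line:
  fixes F :: "('i::finite, 'k::comm_ring_1) mpoly"
  obtains p where "\<And>s. peval (\<lambda>i. a i + s * (b i - a i)) F = poly p s"
proof
  fix s :: 'k
  have "rhom (\<lambda>p. poly p s)" by unfold_locales auto
  from rhom_subst_compose[OF this, of "\<lambda>c. [:c:]" "\<lambda>i. [:a i, b i - a i:]" F]
  show "peval (\<lambda>i. a i + s * (b i - a i)) F =
    poly (subst (\<lambda>c. [:c:]) (\<lambda>i. [:a i, b i - a i:]) F) s"
    by (simp add: peval_def)
qed

lemma polyfun_line:
  assumes "polyfun e \<phi>" and "\<And>s i. e (l s) i = e x i + s * (e y i - e x i)"
  obtains p where "\<And>s. \<phi> (l s) = poly p s"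
proof -
  obtain F where F: "\<And>x. \<phi> x = peval (e x) F" using assms(1) by (auto simp: polyfun_def)
  obtain p where p: "\<And>s. peval (\<lambda>i. e x i + s * (e y i - e x i)) F = poly p s"
    using peval_line by blast
  have "e (l s) = (\<lambda>i. e x i + s * (e y i - e x i))" for s
    by (rule ext) (rule assms(2))
  then have "\<phi> (l s) = poly p s" for s
    by (simp only: F p)
  then show ?thesis by (rule that)
qed

lemma exists_non_root:
  fixes p :: "'k::field poly"
  assumes "infinite (UNIV :: 'k set)" and "p \<noteq> 0"
  shows "\<exists>s. poly p s \<noteq> 0"
  using ex_new_if_finite[OF assms(1) poly_roots_finite[OF assms(2)]] by auto

text \<open>
  Over an infinite field two polynomial functions that are not identically zero have a common
  point of nonvanishing. It lies on the line through a point where the first one does not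
  vanish and a point where the second one does not vanish.
\<close>

lemma polyfun_common_nonzero:
  fixes e :: "'x \<Rightarrow> 'i::finite \<Rightarrow> 'k::field"
  assumes inf: "infinite (UNIV :: 'k set)"
    and "polyfun e \<phi>" "polyfun e \<psi>" "\<phi> x \<noteq> 0" "\<psi> y \<noteq> 0"
    and line: "\<And>s i. e (l s) i = e x i + s * (e y i - e x i)" and l: "l 0 = x" "l 1 = y"
  obtains s where "\<phi> (l s) \<noteq> 0" "\<psi> (l s) \<noteq> 0"
proof -
  obtain p where p: "\<And>s. \<phi> (l s) = poly p s" using polyfun_line assms line by metis
  obtain q where q: "\<And>s. \<psi> (l s) = poly q s" using polyfun_line assms line by metis
  have "poly p 0 \<noteq> 0" "poly q 1 \<noteq> 0" using assms by (auto simp flip: p q)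
  then have "p * q \<noteq> 0" by auto
  from exists_non_root[OF inf this] show ?thesis
    using p q that by auto
qed

text \<open>The coordinates of a matrix, indexed as in the definition of Zariski open sets.\<close>

abbreviation entries :: "'k ^ 'v::finite ^ 'v \<Rightarrow> 'v \<times> 'v \<Rightarrow> 'k" where
  "entries \<equiv> \<lambda>g. \<lambda>(i, j). g $ i $ j"

lemma polyfun_entry: "polyfun entries (\<lambda>g. g $ i $ j)"
  using polyfun_coord[of entries "(i, j)"] by simp

lemma polyfun_det: "polyfun entries (det :: 'k::field ^ 'v::finite ^ 'v \<Rightarrow> 'k)"
  unfolding det_def[abs_def]
  by (intro polyfun_sum polyfun_mult polyfun_const polyfun_prod polyfun_entry)

text \<open>
  Genericity of a property of matrices with a single witness: a polynomial function that is not
  identically zero and whose nonvanishing entails both invertibility and the property. For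
  this form, closure under conjunction is just multiplication of witnesses.
\<close>

definition generic_mat :: "('k::field ^ 'v::finite ^ 'v \<Rightarrow> bool) \<Rightarrow> bool" where
  "generic_mat Q \<longleftrightarrow>
     (\<exists>\<phi>. polyfun entries \<phi> \<and> (\<exists>g. \<phi> g \<noteq> 0) \<and> (\<forall>g. \<phi> g \<noteq> 0 \<longrightarrow> invertible g \<and> Q g))"

lemma generic_matI:
  assumes "polyfun entries \<phi>" "invertible g0" "\<phi> g0 \<noteq> 0"
    and "\<And>g. invertible g \<Longrightarrow> \<phi> g \<noteq> 0 \<Longrightarrow> Q g"
  shows "generic_mat Q"
  unfolding generic_mat_def
  by (rule exI[of _ "\<lambda>g. det g * \<phi> g"])
     (use assms polyfun_det in \<open>auto simp: invertible_det_nz\<close>)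

lemma generic_mat_iff: "for_general_change Q \<longleftrightarrow> generic_mat Q"
proof
  assume "for_general_change Q"
  then obtain S g F where "invertible g" "F \<in> S" "peval (entries g) F \<noteq> 0"
      "\<And>g. invertible g \<Longrightarrow> \<exists>F\<in>S. peval (entries g) F \<noteq> 0 \<Longrightarrow> Q g"
    unfolding for_general_change_def zariski_open_GL_def by blast
  then show "generic_mat Q"
    by (intro generic_matI[of "\<lambda>g. peval (entries g) F"]) (auto intro: polyfun_peval)
next
  assume "generic_mat Q"
  then obtain F g where "peval (entries g) F \<noteq> 0"
      "\<And>g. peval (entries g) F \<noteq> 0 \<Longrightarrow> invertible g \<and> Q g"
    unfolding generic_mat_def polyfun_def by auto
  then show "for_general_change Q"
    unfolding for_general_change_def zariski_open_GL_def
    by (intro exI[of _ "{g. invertible g \<and> (\<exists>F\<in>{F}. peval (entries g) F \<noteq> 0)}"]) auto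
qed

lemma generic_mat_mono: "generic_mat Q \<Longrightarrow> (\<And>g. invertible g \<Longrightarrow> Q g \<Longrightarrow> Q' g) \<Longrightarrow> generic_mat Q'"
  unfolding generic_mat_def by meson

lemma generic_mat_ex: "generic_mat Q \<Longrightarrow> \<exists>g. invertible g \<and> Q g"
  unfolding generic_mat_def by auto

lemma generic_mat_conj:
  assumes inf: "infinite (UNIV :: 'k::field set)"
    and "generic_mat (Q :: 'k ^ 'v::finite ^ 'v \<Rightarrow> bool)" "generic_mat Q'"
  shows "generic_mat (\<lambda>g. Q g \<and> Q' g)"
proof -
  obtain \<phi> x where 1: "polyfun entries \<phi>" "\<phi> x \<noteq> 0" "\<And>g. \<phi> g \<noteq> 0 \<Longrightarrow> invertible g \<and> Q g"
    using assms(2) unfolding generic_mat_def by auto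
  obtain \<psi> y where 2: "polyfun entries \<psi>" "\<psi> y \<noteq> 0" "\<And>g. \<psi> g \<noteq> 0 \<Longrightarrow> invertible g \<and> Q' g"
    using assms(3) unfolding generic_mat_def by auto
  define l :: "'k \<Rightarrow> 'k ^ 'v ^ 'v" where
    "l = (\<lambda>s. \<chi> i j. x $ i $ j + s * (y $ i $ j - x $ i $ j))"
  obtain s where s: "\<phi> (l s) \<noteq> 0" "\<psi> (l s) \<noteq> 0"
  proof (rule polyfun_common_nonzero[OF inf 1(1) 2(1) 1(2) 2(2), of l])
    show "l 0 = x" "l 1 = y" by (simp_all add: l_def vec_eq_iff)
  qed (auto simp: l_def)
  with 1 2 show ?thesis
    unfolding generic_mat_def by (intro exI[of _ "\<lambda>g. \<phi> g * \<psi> g"]) auto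
qed

lemma generic_mat_ball:
  assumes inf: "infinite (UNIV :: 'k::field set)" and "finite A"
    and "\<And>t. t \<in> A \<Longrightarrow> generic_mat (Q t :: 'k ^ 'v::finite ^ 'v \<Rightarrow> bool)"
  shows "generic_mat (\<lambda>g. \<forall>t\<in>A. Q t g)"
  using assms(2,3)
proof induction
  case empty
  have "generic_mat (\<lambda>g :: 'k ^ 'v ^ 'v. True)"
    by (rule generic_matI[of "\<lambda>_. 1" "mat 1"]) (auto simp: invertible_def)
  then show ?case by simp
next
  case (insert t A)
  then have "generic_mat (\<lambda>g. Q t g \<and> (\<forall>t\<in>A. Q t g))"
    by (intro generic_mat_conj[OF inf]) auto
  then show ?case by simp
qed

section \<open>Vector spaces, ideals and gradings\<close>

lemma const_mult_single [simp]:
  "const c * Poly_Mapping.single u x = Poly_Mapping.single u (c * x)"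
  by (simp add: const_def mult_single)

lemma lookup_const_mult [simp]:
  "Poly_Mapping.lookup (const c * f) u = c * Poly_Mapping.lookup f u"
proof (induction f rule: mpoly_induct)
  case (add w y f)
  then show ?case
    by (simp add: distrib_left lookup_add lookup_single when_def)
qed simp

interpretation kspace: vector_space "scale :: 'k::field \<Rightarrow> ('v, 'k) mpoly \<Rightarrow> ('v, 'k) mpoly"
  by unfold_locales
     (simp_all add: scale_def distrib_left distrib_right rhom.add[OF rhom_const]
       rhom.mult[OF rhom_const] rhom.one[OF rhom_const] mult.assoc)

lemma module_ring: "module ((*) :: 'r::comm_ring_1 \<Rightarrow> 'r \<Rightarrow> 'r)"
  by unfold_locales (auto simp: algebra_simps)

lemma lookup_scale [simp]: "Poly_Mapping.lookup (scale c f) u = c * Poly_Mapping.lookup f u"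
  by (simp add: scale_def)

lemma is_ideal_iff:
  "is_ideal I \<longleftrightarrow> 0 \<in> I \<and> (\<forall>f\<in>I. \<forall>g\<in>I. f + g \<in> I) \<and> (\<forall>h. \<forall>f\<in>I. h * f \<in> I)"
  unfolding is_ideal_def module.subspace_def[OF module_ring] by simp

lemma ideal_gen_least: "B \<subseteq> I \<Longrightarrow> is_ideal I \<Longrightarrow> ideal_gen B \<subseteq> I"
  unfolding ideal_gen_def is_ideal_def by (rule module.span_minimal[OF module_ring])

lemma ideal_gen_is_ideal: "is_ideal (ideal_gen B)"
  unfolding ideal_gen_def is_ideal_def by (rule module.subspace_span[OF module_ring])

lemma ideal_gen_superset: "B \<subseteq> ideal_gen B"
  unfolding ideal_gen_def by (rule module.span_superset[OF module_ring])

lemma is_ideal_subspace: "is_ideal I \<Longrightarrow> kspace.subspace I"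
  by (auto simp: is_ideal_iff kspace.subspace_def scale_def)

lemma lookup_single_mult:
  "Poly_Mapping.lookup (Poly_Mapping.single w 1 * f) (w + u) = Poly_Mapping.lookup f u"
  for f :: "('v, 'k::field) mpoly"
  by (induction f rule: mpoly_induct) (simp_all add: distrib_left lookup_add mult_single lookup_single when_def)

text \<open>The polynomials all of whose monomials lie in a given set.\<close>

definition supported :: "('v \<Rightarrow>\<^sub>0 nat) set \<Rightarrow> ('v, 'k::field) mpoly set" where
  "supported M = {f. Poly_Mapping.keys f \<subseteq> M}"

lemma supported_subspace:
  "kspace.subspace (supported M :: ('v, 'k::field) mpoly set)"
  unfolding kspace.subspace_def
proof (intro conjI ballI allI)
  show "x + y \<in> supported M" if "x \<in> supported M" "y \<in> supported M"
    for x y :: "('v, 'k) mpoly"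
    using that keys_add[of x y] by (auto simp: supported_def)
qed (auto simp: supported_def in_keys_iff)

lemma kspan_monomials:
  "kspan (mono_poly ` M) = (supported M :: ('v, 'k::field) mpoly set)"
proof -
  have "f \<in> kspan (mono_poly ` M)" if "Poly_Mapping.keys f \<subseteq> M" for f :: "('v, 'k) mpoly"
  proof -
    have "(\<Sum>u\<in>Poly_Mapping.keys f. Poly_Mapping.single u (Poly_Mapping.lookup f u)) =
       (\<Sum>u\<in>Poly_Mapping.keys f. scale (Poly_Mapping.lookup f u) (mono_poly u))"
      by (simp add: scale_def mono_poly_def)
    also have "\<dots> \<in> kspan (mono_poly ` M)"
      unfolding kspan_def
      by (intro kspace.span_sum kspace.span_scale kspace.span_base) (use that in auto)
    finally show ?thesis by (simp flip: poly_mapping_decompose)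
  qed
  moreover have "kspan (mono_poly ` M) \<subseteq> supported M"
    unfolding kspan_def
    by (rule kspace.span_minimal) (auto simp: supported_def mono_poly_def intro: supported_subspace[unfolded supported_def])
  ultimately show ?thesis by (auto simp: supported_def)
qed

lemma supported_is_ideal:
  assumes "\<And>z u. u \<in> M \<Longrightarrow> z + u \<in> M"
  shows "is_ideal (supported M :: ('v, 'k::field) mpoly set)"
proof -
  have "h * f \<in> supported M" if "f \<in> supported M" for h f :: "('v, 'k) mpoly"
    unfolding supported_def
  proof (clarify)
    fix w assume "w \<in> Poly_Mapping.keys (h * f)"
    then obtain z u where "w = z + u" "u \<in> Poly_Mapping.keys f"
      using keys_mult[of h f] by blast
    with that show "w \<in> M"
      by (auto simp: supported_def intro: assms)
  qed
  then show ?thesis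
    using supported_subspace[of M] by (auto simp: is_ideal_iff kspace.subspace_def)
qed

lemma supported_subset_ideal:
  assumes "is_ideal I" "\<And>u. u \<in> M \<Longrightarrow> mono_poly u \<in> I"
  shows "supported M \<subseteq> I"
  unfolding kspan_monomials[symmetric] kspan_def
  by (rule kspace.span_minimal) (use assms is_ideal_subspace in auto)

lemma supported_inject: "supported M = (supported N :: ('v, 'k::field) mpoly set) \<longleftrightarrow> M = N"
proof
  assume *: "supported M = (supported N :: ('v, 'k) mpoly set)"
  have "u \<in> M' \<longleftrightarrow> (mono_poly u :: ('v, 'k) mpoly) \<in> supported M'" for u M'
    by (simp add: supported_def mono_poly_def)
  with * show "M = N" by blast
qed simp

lemma mdeg_UNIV: "mdeg u = (\<Sum>i\<in>UNIV. Poly_Mapping.lookup u i)" for u :: "'v::finite \<Rightarrow>\<^sub>0 nat"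
  unfolding mdeg_def by (rule sum.mono_neutral_left) (auto simp: in_keys_iff)

lemma mdeg_add: "mdeg (u + w) = mdeg u + mdeg w" for u :: "'v::finite \<Rightarrow>\<^sub>0 nat"
  by (simp add: mdeg_UNIV lookup_add sum.distrib)

lemma mdeg_single [simp]: "mdeg (Poly_Mapping.single i e) = e"
  by (simp add: mdeg_def)

lemma mdeg_zero [simp]: "mdeg 0 = 0"
  by (simp add: mdeg_def)

lemma finite_mdeg: "finite {u :: 'v::finite \<Rightarrow>\<^sub>0 nat. mdeg u = d}"
proof (rule finite_imageD)
  show "inj_on Poly_Mapping.lookup {u :: 'v \<Rightarrow>\<^sub>0 nat. mdeg u = d}"
    by (simp add: inj_on_def)
  have "Poly_Mapping.lookup u i \<le> mdeg u" for u :: "'v \<Rightarrow>\<^sub>0 nat" and i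
    unfolding mdeg_UNIV by (rule member_le_sum) auto
  then have "Poly_Mapping.lookup ` {u :: 'v \<Rightarrow>\<^sub>0 nat. mdeg u = d} \<subseteq> (UNIV \<rightarrow>\<^sub>E {..d})"
    by auto
  then show "finite (Poly_Mapping.lookup ` {u :: 'v \<Rightarrow>\<^sub>0 nat. mdeg u = d})"
    by (rule finite_subset) (auto intro: finite_PiE)
qed

lemma homogeneous_mult:
  fixes f :: "('v::finite, 'k::comm_ring_1) mpoly"
  shows "homogeneous d f \<Longrightarrow> homogeneous e g \<Longrightarrow> homogeneous (d + e) (f * g)"
  using keys_mult[of f g] by (fastforce simp: homogeneous_def mdeg_add)

lemma homogeneous_add: "homogeneous d f \<Longrightarrow> homogeneous d g \<Longrightarrow> homogeneous d (f + g)"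
  using keys_add[of f g] by (auto simp: homogeneous_def)

lemma homogeneous_zero [simp]: "homogeneous d 0"
  by (simp add: homogeneous_def)

lemma homogeneous_sum: "(\<And>i. i \<in> A \<Longrightarrow> homogeneous d (f i)) \<Longrightarrow> homogeneous d (\<Sum>i\<in>A. f i)"
  by (induction A rule: infinite_finite_induct) (auto intro: homogeneous_add)

lemma homogeneous_const: "homogeneous 0 (const c)"
  by (simp add: homogeneous_def const_def)

lemma homogeneous_xvar: "homogeneous 1 (xvar i)"
  by (simp add: homogeneous_def xvar_def mono_poly_def)

lemma homogeneous_monom_value:
  fixes \<sigma> :: "'v::finite \<Rightarrow> ('v, 'k::comm_ring_1) mpoly"
  assumes "\<And>i. homogeneous 1 (\<sigma> i)"
  shows "homogeneous (mdeg u) (monom_value \<sigma> u)"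
proof -
  have one: "homogeneous 0 (1 :: ('v, 'k) mpoly)"
    using homogeneous_const[of 1] by (simp add: const_def)
  have pow: "homogeneous e (\<sigma> i ^ e)" for i e
    by (induction e) (use one homogeneous_mult[OF assms] in auto)
  have "homogeneous (\<Sum>i\<in>A. Poly_Mapping.lookup u i) (\<Prod>i\<in>A. \<sigma> i ^ Poly_Mapping.lookup u i)" for A
    by (induction A rule: infinite_finite_induct) (use one in \<open>auto intro: homogeneous_mult pow\<close>)
  then show ?thesis by (simp add: monom_value_def mdeg_UNIV)
qed

lemma homogeneous_change_vars:
  assumes "homogeneous d f" shows "homogeneous d (change_vars g f)"
  unfolding change_vars_def subst_def monom_value_keys
proof (rule homogeneous_sum)
  fix u assume "u \<in> Poly_Mapping.keys f"
  then have d: "mdeg u = d" using assms by (simp add: homogeneous_def)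
  have "homogeneous 1 (\<Sum>j\<in>UNIV. const (g $ i $ j) * xvar j)" for i
    using homogeneous_mult[OF homogeneous_const homogeneous_xvar]
    by (intro homogeneous_sum) simp
  from homogeneous_mult[OF homogeneous_const homogeneous_monom_value[OF this]]
  show "homogeneous d (const (Poly_Mapping.lookup f u) *
      monom_value (\<lambda>i. \<Sum>j\<in>UNIV. const (g $ i $ j) * xvar j) u)"
    unfolding d[symmetric] by simp
qed

text \<open>The homogeneous part of degree \<open>d\<close>.\<close>

definition hom_part :: "nat \<Rightarrow> ('v, 'k::comm_ring_1) mpoly \<Rightarrow> ('v, 'k) mpoly" where
  "hom_part d f =
     (\<Sum>u\<in>{u \<in> Poly_Mapping.keys f. mdeg u = d}. Poly_Mapping.single u (Poly_Mapping.lookup f u))"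

lemma lookup_hom_part:
  "Poly_Mapping.lookup (hom_part d f) u = (if mdeg u = d then Poly_Mapping.lookup f u else 0)"
  by (auto simp: hom_part_def lookup_sum lookup_single when_def in_keys_iff sum.delta')

lemma homogeneous_hom_part [simp]: "homogeneous d (hom_part d f)"
  by (auto simp: homogeneous_def in_keys_iff lookup_hom_part split: if_splits)

lemma hom_part_add: "hom_part d (f + g) = hom_part d f + hom_part d g"
  by (rule poly_mapping_eqI) (simp add: lookup_hom_part lookup_add)

lemma hom_part_zero [simp]: "hom_part d 0 = 0"
  by (rule poly_mapping_eqI) (simp add: lookup_hom_part)

lemma hom_part_homogeneous: "homogeneous e f \<Longrightarrow> hom_part d f = (if d = e then f else 0)"
  by (rule poly_mapping_eqI) (auto simp: lookup_hom_part homogeneous_def in_keys_iff)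

lemma hom_part_mult_single:
  fixes f :: "('v::finite, 'k::comm_ring_1) mpoly"
  shows "hom_part d (Poly_Mapping.single u c * f) =
    (if mdeg u \<le> d then Poly_Mapping.single u c * hom_part (d - mdeg u) f else 0)"
proof (induction f rule: mpoly_induct)
  case (add w y f)
  have "homogeneous (mdeg (u + w)) (Poly_Mapping.single (u + w) (c * y))"
       "homogeneous (mdeg w) (Poly_Mapping.single w y)"
    by (auto simp: homogeneous_def)
  note this[THEN hom_part_homogeneous]
  with add show ?case
    by (auto simp: distrib_left hom_part_add mult_single mdeg_add)
qed simp

text \<open>
  Homogeneity of an ideal in elementary form: the homogeneous parts of its elements belong to
  it. This form passes to the image under a linear change of variables.
\<close>

definition graded_ideal :: "('v, 'k::field) mpoly set \<Rightarrow> bool" where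
  "graded_ideal I \<longleftrightarrow> is_ideal I \<and> (\<forall>f\<in>I. \<forall>d. hom_part d f \<in> I)"

lemma homogeneous_ideal_graded:
  fixes I :: "('v::finite, 'k::field) mpoly set"
  assumes "homogeneous_ideal I" shows "graded_ideal I"
proof -
  let ?G = "{f \<in> I. \<exists>d. homogeneous d f}"
  let ?J = "{f. \<forall>d. hom_part d f \<in> I}"
  from assms have I: "is_ideal I" and gen: "I = ideal_gen ?G"
    unfolding homogeneous_ideal_def by blast+
  have mult: "h * f \<in> ?J" if "f \<in> ?J" for h f
  proof (induction h rule: mpoly_induct)
    case zero
    then show ?case using I by (simp add: is_ideal_iff)
  next
    case (add u c h)
    then show ?case using I that
      by (auto simp: is_ideal_iff distrib_right hom_part_add hom_part_mult_single)
  qed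
  then have "is_ideal ?J"
    using I by (auto simp: is_ideal_iff hom_part_add)
  moreover have "?G \<subseteq> ?J"
    using I by (auto simp: hom_part_homogeneous is_ideal_iff)
  ultimately have "ideal_gen ?G \<subseteq> ?J" by (intro ideal_gen_least)
  with gen I show ?thesis by (auto simp: graded_ideal_def)
qed

lemma hom_part_change_vars: "hom_part d (change_vars g f) = change_vars g (hom_part d f)"
proof (induction f rule: mpoly_induct)
  case (add u c f)
  have "homogeneous (mdeg u) (Poly_Mapping.single u c)" by (auto simp: homogeneous_def)
  from hom_part_homogeneous[OF this] hom_part_homogeneous[OF homogeneous_change_vars[OF this]] add
  show ?case by (simp add: hom_part_add change_vars_add change_vars_zero)
qed (simp add: change_vars_zero)

lemma is_ideal_image_change_vars:
  assumes "is_ideal I" "invertible g" shows "is_ideal (change_vars g ` I)"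
proof -
  have "h * change_vars g f \<in> change_vars g ` I" if "f \<in> I" for h f
  proof -
    obtain h' where "h = change_vars g h'"
      using bij_change_vars[OF assms(2)] by (metis bij_pointE)
    then show ?thesis
      using assms(1) that by (auto simp: is_ideal_iff simp flip: change_vars_mult)
  qed
  then show ?thesis
    using assms(1) by (auto simp: is_ideal_iff simp flip: change_vars_add)
      (metis change_vars_zero image_eqI)
qed

lemma graded_ideal_image_change_vars:
  assumes "graded_ideal I" "invertible g" shows "graded_ideal (change_vars g ` I)"
  using assms is_ideal_image_change_vars[of I g]
  by (auto simp: graded_ideal_def hom_part_change_vars)

lemma component_image_change_vars:
  assumes "invertible g"
  shows "component (change_vars g ` I) t = change_vars g ` component I t"
proof -
  obtain h where h: "\<And>f. change_vars h (change_vars g f) = f"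
    using change_vars_inverse[OF assms] by metis
  have "homogeneous t (change_vars g f) \<longleftrightarrow> homogeneous t f" for f
    using homogeneous_change_vars[of t f g] homogeneous_change_vars[of t "change_vars g f" h]
    by (auto simp: h)
  then show ?thesis by (auto simp: component_def)
qed

lemma component_subspace:
  fixes I :: "('v::finite, 'k::field) mpoly set"
  shows "is_ideal I \<Longrightarrow> kspace.subspace (component I t)"
  by (auto simp: is_ideal_iff kspace.subspace_def component_def scale_def
      intro: homogeneous_add homogeneous_mult[OF homogeneous_const, simplified])

lemma subspace_image_change_vars:
  assumes "kspace.subspace V" shows "kspace.subspace (change_vars g ` V)"
  unfolding kspace.subspace_def
proof (intro conjI ballI allI)
  show "0 \<in> change_vars g ` V"
    using assms by (metis change_vars_zero image_eqI kspace.subspace_0)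
  show "x + y \<in> change_vars g ` V" if "x \<in> change_vars g ` V" "y \<in> change_vars g ` V" for x y
    using that assms by (auto simp: kspace.subspace_def simp flip: change_vars_add)
  show "scale c x \<in> change_vars g ` V" if "x \<in> change_vars g ` V" for c x
  proof -
    from that obtain f where "f \<in> V" "x = change_vars g f" by auto
    then have "scale c x = change_vars g (scale c f)" "scale c f \<in> V"
      using assms by (simp_all add: scale_def change_vars_mult kspace.subspace_def)
    then show ?thesis by auto
  qed
qed

lemma kdim_image_change_vars:
  assumes "invertible g" shows "kdim (change_vars g ` V) = kdim V"
proof -
  have lin: "Vector_Spaces.linear scale scale (change_vars g)"
    by unfold_locales (auto simp: change_vars_add scale_def change_vars_mult)
  interpret L: Vector_Spaces.linear scale scale "change_vars g" by (rule lin)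
  have inj: "inj (change_vars g)" using bij_change_vars[OF assms] by (rule bij_is_inj)
  obtain B where B: "B \<subseteq> V" "kspace.independent B" "V \<subseteq> kspace.span B" "card B = kspace.dim V"
    by (rule kspace.basis_exists)
  have "kspace.dim (change_vars g ` V) = card B"
  proof (rule kspace.dim_unique)
    show "change_vars g ` V \<subseteq> kspace.span (change_vars g ` B)"
      using B(3) by (auto simp: L.span_image)
    show "kspace.independent (change_vars g ` B)"
      using B(2) inj by (intro L.independent_injective_image) (auto intro: inj_on_subset)
    show "card (change_vars g ` B) = card B"
      using inj by (intro card_image) (auto intro: inj_on_subset)
  qed (use B in auto)
  with B show ?thesis by (simp add: kdim_def)
qed

section \<open>Leading monomials and dimension\<close>

text \<open>The leading monomials of the nonzero elements of a set of polynomials.\<close>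

definition lead_set :: "('v::linorder, 'k::field) mpoly set \<Rightarrow> ('v \<Rightarrow>\<^sub>0 nat) set" where
  "lead_set W = {lead_monomial f | f. f \<in> W \<and> f \<noteq> 0}"

lemma lead_monomial_in_keys: "f \<noteq> 0 \<Longrightarrow> lead_monomial f \<in> Poly_Mapping.keys f"
  unfolding lead_monomial_def by (intro Max_in) auto

lemma lead_monomial_ge: "u \<in> Poly_Mapping.keys f \<Longrightarrow> u \<le> lead_monomial f"
  unfolding lead_monomial_def by (intro Max_ge) auto

lemma lead_monomial_eqI:
  "u \<in> Poly_Mapping.keys f \<Longrightarrow> (\<And>w. w \<in> Poly_Mapping.keys f \<Longrightarrow> w \<le> u) \<Longrightarrow> lead_monomial f = u"
  unfolding lead_monomial_def by (intro Max_eqI) auto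

lemma lead_setI: "f \<in> W \<Longrightarrow> f \<noteq> 0 \<Longrightarrow> lead_monomial f \<in> lead_set W"
  by (auto simp: lead_set_def)

lemma lead_set_component:
  fixes J :: "('v::{finite, linorder}, 'k::field) mpoly set"
  assumes "graded_ideal J"
  shows "lead_set (component J t) = {u \<in> lead_set J. mdeg u = t}"
proof (intro equalityI subsetI)
  fix u assume "u \<in> lead_set (component J t)"
  then obtain f where f: "f \<in> J" "homogeneous t f" "f \<noteq> 0" "u = lead_monomial f"
    by (auto simp: lead_set_def component_def)
  with lead_monomial_in_keys[of f] show "u \<in> {u \<in> lead_set J. mdeg u = t}"
    by (auto simp: lead_set_def homogeneous_def)
next
  fix u assume "u \<in> {u \<in> lead_set J. mdeg u = t}"
  then obtain f where f: "f \<in> J" "f \<noteq> 0" "u = lead_monomial f" "mdeg u = t"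
    by (auto simp: lead_set_def)
  have u: "u \<in> Poly_Mapping.keys (hom_part t f)"
    using f lead_monomial_in_keys[of f] by (simp add: in_keys_iff lookup_hom_part)
  have "lead_monomial (hom_part t f) = u"
  proof (rule lead_monomial_eqI[OF u])
    fix w assume "w \<in> Poly_Mapping.keys (hom_part t f)"
    then have "w \<in> Poly_Mapping.keys f"
      by (simp add: in_keys_iff lookup_hom_part split: if_splits)
    then show "w \<le> u" unfolding f(3) by (rule lead_monomial_ge)
  qed
  moreover have "hom_part t f \<in> component J t"
    using assms f by (simp add: component_def graded_ideal_def)
  moreover have "hom_part t f \<noteq> 0" using u by auto
  ultimately show "u \<in> lead_set (component J t)" by (metis lead_setI)
qed

lemma lead_set_add:
  fixes J :: "('v::{finite, linorder}, 'k::field) mpoly set"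
  assumes "is_ideal J" "u \<in> lead_set J"
  shows "z + u \<in> lead_set J"
proof -
  obtain f where f: "f \<in> J" "f \<noteq> 0" "u = lead_monomial f"
    using assms(2) by (auto simp: lead_set_def)
  let ?h = "Poly_Mapping.single z 1 * f"
  have u: "u \<in> Poly_Mapping.keys f" using f lead_monomial_in_keys by blast
  then have zu: "z + u \<in> Poly_Mapping.keys ?h" by (simp add: in_keys_iff lookup_single_mult)
  have "lead_monomial ?h = z + u"
  proof (rule lead_monomial_eqI[OF zu])
    fix w assume "w \<in> Poly_Mapping.keys ?h"
    from subsetD[OF keys_mult this] obtain w' where "w = z + w'" "w' \<in> Poly_Mapping.keys f"
      by auto
    then show "w \<le> z + u" using lead_monomial_ge[of w' f] f(3) by (simp add: add_left_mono)
  qed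
  moreover have "?h \<in> J" "?h \<noteq> 0" using assms(1) f(1) zu by (auto simp: is_ideal_iff)
  ultimately show ?thesis by (metis lead_setI)
qed

text \<open>
  The leading monomials of an ideal are closed under multiplication by monomials, so the
  initial ideal is already their linear span.
\<close>

lemma initial_ideal_eq:
  fixes J :: "('v::{finite, linorder}, 'k::field) mpoly set"
  assumes "is_ideal J"
  shows "initial_ideal J = supported (lead_set J)"
proof
  have gens: "{mono_poly (lead_monomial f) | f. f \<in> J \<and> f \<noteq> 0} = mono_poly ` lead_set J"
    by (auto simp: lead_set_def)
  have "is_ideal (supported (lead_set J) :: ('v, 'k) mpoly set)"
    by (rule supported_is_ideal) (rule lead_set_add[OF assms])
  then show "initial_ideal J \<subseteq> supported (lead_set J)"
    unfolding initial_ideal_def gens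
    by (intro ideal_gen_least) (auto simp: supported_def mono_poly_def)
  show "supported (lead_set J) \<subseteq> initial_ideal J"
    unfolding initial_ideal_def gens
    by (rule supported_subset_ideal[OF ideal_gen_is_ideal], rule subsetD[OF ideal_gen_superset],
        rule imageI)
qed

lemma component_supported: "component (supported M) t = supported {u \<in> M. mdeg u = t}"
  by (auto simp: component_def supported_def homogeneous_def)

text \<open>The largest leading monomial of the terms that occur cannot cancel.\<close>

lemma combination_nonzero:
  assumes "finite A" "inj_on lead_monomial A" "0 \<notin> A" "\<exists>f\<in>A. a f \<noteq> 0"
  shows "(\<Sum>f\<in>A. scale (a f) f) \<noteq> 0"
proof -
  define A' where "A' = {f \<in> A. a f \<noteq> 0}"
  have fin: "finite (lead_monomial ` A')" and ne: "lead_monomial ` A' \<noteq> {}"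
    using assms by (auto simp: A'_def)
  from Max_in[OF this] obtain f where f: "f \<in> A'" "lead_monomial f = Max (lead_monomial ` A')"
    by auto
  have "a g * Poly_Mapping.lookup g (lead_monomial f) = 0" if "g \<in> A - {f}" for g
  proof (cases "a g = 0")
    case False
    with that have "lead_monomial g \<le> lead_monomial f"
      unfolding f(2) by (intro Max_ge fin) (auto simp: A'_def)
    moreover have "lead_monomial g \<noteq> lead_monomial f"
      using inj_onD[OF assms(2), of g f] that f(1) by (auto simp: A'_def)
    ultimately have "lead_monomial f \<notin> Poly_Mapping.keys g"
      using lead_monomial_ge[of "lead_monomial f" g] by auto
    then show ?thesis by (simp add: in_keys_iff)
  qed simp
  then have "(\<Sum>g\<in>A - {f}. a g * Poly_Mapping.lookup g (lead_monomial f)) = 0"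
    by (intro sum.neutral) blast
  then have "Poly_Mapping.lookup (\<Sum>g\<in>A. scale (a g) g) (lead_monomial f) =
      a f * Poly_Mapping.lookup f (lead_monomial f)"
    using f(1) assms(1) by (simp add: lookup_sum lookup_add sum.remove[of A f] A'_def)
  moreover have "Poly_Mapping.lookup f (lead_monomial f) \<noteq> 0"
    using lead_monomial_in_keys[of f] f(1) assms(3) by (auto simp: A'_def in_keys_iff)
  ultimately show ?thesis using f(1) by (auto simp: A'_def)
qed

text \<open>The dimension of a subspace is the number of its leading monomials.\<close>

lemma kdim_eq_card_lead_set:
  fixes W :: "('v::linorder, 'k::field) mpoly set"
  assumes W: "kspace.subspace W" and fin: "finite (lead_set W)"
  shows "kdim W = card (lead_set W)"
proof -
  obtain F where F: "\<And>w. w \<in> lead_set W \<Longrightarrow> F w \<in> W \<and> F w \<noteq> 0 \<and> lead_monomial (F w) = w"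
    using bchoice[of "lead_set W" "\<lambda>w f. f \<in> W \<and> f \<noteq> 0 \<and> lead_monomial f = w"]
    by (auto simp: lead_set_def)
  let ?B = "F ` lead_set W"
  have inj: "inj_on F (lead_set W)" by (rule inj_on_inverseI[of _ lead_monomial]) (simp add: F)
  have "inj_on lead_monomial ?B" by (auto intro!: inj_onI simp: F)
  moreover have "0 \<notin> ?B" using F by force
  ultimately have indep: "kspace.independent ?B"
    using combination_nonzero[of ?B] fin by (subst kspace.dependent_finite) blast+
  have span: "f \<in> kspace.span ?B" if "f \<in> W" for f
    using that
  proof (induction "card {u \<in> lead_set W. u < lead_monomial f}" arbitrary: f rule: less_induct)
    case less
    show ?case
    proof (cases "f = 0")
      case False
      define w where "w = lead_monomial f"
      have w: "w \<in> lead_set W" using False less.prems by (simp add: w_def lead_setI)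
      \<comment> \<open>One step of reduction: cancel the leading term of \<open>f\<close>.\<close>
      define c where "c = Poly_Mapping.lookup f w / Poly_Mapping.lookup (F w) w"
      define f' where "f' = f - scale c (F w)"
      have Fw: "Poly_Mapping.lookup (F w) w \<noteq> 0"
        using F[OF w] lead_monomial_in_keys[of "F w"] by (simp add: in_keys_iff)
      have f'W: "f' \<in> W"
        unfolding f'_def using F[OF w] less.prems W
        by (intro kspace.subspace_diff kspace.subspace_scale) auto
      have "f' \<in> kspace.span ?B"
      proof (cases "f' = 0")
        case True
        then show ?thesis by (simp add: kspace.span_zero)
      next
        case f': False
        have "lead_monomial f' \<in> Poly_Mapping.keys f'" by (rule lead_monomial_in_keys[OF f'])
        then have "Poly_Mapping.lookup f' (lead_monomial f') \<noteq> 0" by (simp add: in_keys_iff)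
        then have "lead_monomial f' \<in> Poly_Mapping.keys f \<or> lead_monomial f' \<in> Poly_Mapping.keys (F w)"
          and "lead_monomial f' \<noteq> w"
          using Fw by (auto simp: f'_def lookup_minus in_keys_iff c_def)
        then have lt: "lead_monomial f' < w"
          using lead_monomial_ge F[OF w] w_def by fastforce
        have "{u \<in> lead_set W. u < lead_monomial f'} \<subset> {u \<in> lead_set W. u < w}"
          using lt lead_setI[OF f'W f'] by auto
        then show ?thesis
          using fin f'W by (intro less.hyps) (auto simp: w_def intro!: psubset_card_mono)
      qed
      moreover have "scale c (F w) \<in> kspace.span ?B"
        using w by (intro kspace.span_scale kspace.span_base) auto
      ultimately have "f' + scale c (F w) \<in> kspace.span ?B" by (rule kspace.span_add)
      then show ?thesis by (simp add: f'_def)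
    qed (simp add: kspace.span_zero)
  qed
  show ?thesis unfolding kdim_def
    by (rule kspace.dim_unique[of ?B]) (use F span indep inj in \<open>auto simp: card_image\<close>)
qed

text \<open>
  A family whose coefficient matrix with respect to monomials above \<open>u\<close> is nonsingular
  spans a subspace all of whose leading monomials lie above \<open>u\<close>.
\<close>

lemma card_le_card_lead_set:
  fixes W :: "('v::linorder, 'k::field) mpoly set"
  assumes W: "kspace.subspace W" and fin: "finite (lead_set W)"
    and A: "finite A" "\<And>w. w \<in> A \<Longrightarrow> u \<le> w" and h: "\<And>w. w \<in> A \<Longrightarrow> h w \<in> W"
    and nonsing: "\<And>a. (\<And>w'. w' \<in> A \<Longrightarrow> (\<Sum>w\<in>A. a w * Poly_Mapping.lookup (h w) w') = 0) \<Longrightarrow>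
       \<forall>w\<in>A. a w = 0"
  shows "card A \<le> card {w \<in> lead_set W. u \<le> w}"
proof -
  have inj: "inj_on h A"
  proof (rule inj_onI, rule ccontr)
    fix x y assume xy: "x \<in> A" "y \<in> A" "h x = h y" "x \<noteq> y"
    define a where "a = (\<lambda>w. if w = x then 1 else if w = y then - 1 else (0::'k))"
    have "(\<Sum>w\<in>A. a w * Poly_Mapping.lookup (h w) w') = 0" for w'
    proof -
      have "(\<Sum>w\<in>A. a w * Poly_Mapping.lookup (h w) w') =
            (\<Sum>w\<in>{x, y}. a w * Poly_Mapping.lookup (h w) w')"
        using xy A(1) by (intro sum.mono_neutral_right) (auto simp: a_def)
      then show ?thesis using xy by (simp add: a_def)
    qed
    with nonsing[of a] xy(1) show False by (auto simp: a_def)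
  qed
  have sum_image: "Poly_Mapping.lookup (\<Sum>v\<in>h ` A. scale (b v) v) w' =
      (\<Sum>w\<in>A. b (h w) * Poly_Mapping.lookup (h w) w')" for b w'
    by (simp add: sum.reindex[OF inj] lookup_sum)
  have indep: "kspace.independent (h ` A)"
    using nonsing[of "\<lambda>w. b (h w)" for b] A(1)
    by (subst kspace.dependent_finite) (auto simp flip: sum_image)
  let ?W = "kspace.span (h ` A)"
  have sub: "?W \<subseteq> W" using h W by (intro kspace.span_minimal) auto
  have lead: "lead_set ?W \<subseteq> {w \<in> lead_set W. u \<le> w}"
  proof
    fix w assume "w \<in> lead_set ?W"
    then obtain f where f: "f \<in> ?W" "f \<noteq> 0" "w = lead_monomial f" by (auto simp: lead_set_def)
    from f(1) A(1) obtain b where b: "f = (\<Sum>v\<in>h ` A. scale (b v) v)"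
      by (auto simp: kspace.span_finite)
    have "\<exists>w'\<in>A. Poly_Mapping.lookup f w' \<noteq> 0"
    proof (rule ccontr)
      assume "\<not> ?thesis"
      then have "\<forall>w\<in>A. b (h w) = 0"
        using nonsing[of "\<lambda>w. b (h w)"] by (simp add: b sum_image)
      then have "f = 0" unfolding b by (intro sum.neutral) auto
      with f show False by simp
    qed
    then obtain w' where "w' \<in> A" "w' \<in> Poly_Mapping.keys f" by (auto simp: in_keys_iff)
    then have "u \<le> w" using A(2) lead_monomial_ge[of w' f] f(3) by (metis order_trans)
    then show "w \<in> {w \<in> lead_set W. u \<le> w}" using f sub by (auto intro: lead_setI)
  qed
  then have "finite (lead_set ?W)" using fin by (metis (no_types, lifting) finite_subset mem_Collect_eq subsetI)
  then have "card (lead_set ?W) = kdim ?W"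
    by (intro kdim_eq_card_lead_set[symmetric]) auto
  also have "\<dots> = card A"
    unfolding kdim_def using indep by (simp add: kspace.dim_eq_card_independent card_image inj)
  finally show ?thesis using lead fin by (metis (no_types, lifting) card_mono finite_subset mem_Collect_eq subsetI)
qed

section \<open>Existence of the generic initial ideal\<close>

text \<open>Families of polynomials whose coefficients are polynomial functions of a parameter.\<close>

inductive polyfamily ::
    "('x \<Rightarrow> 'i::finite \<Rightarrow> 'k::field) \<Rightarrow> ('x \<Rightarrow> ('v::finite, 'k) mpoly) \<Rightarrow> bool" for e where
  zero: "polyfamily e (\<lambda>x. 0)"
| single: "polyfun e \<phi> \<Longrightarrow> polyfamily e (\<lambda>x. Poly_Mapping.single u (\<phi> x))"
| add: "polyfamily e f \<Longrightarrow> polyfamily e g \<Longrightarrow> polyfamily e (\<lambda>x. f x + g x)"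

lemma polyfamily_mult:
  assumes "polyfamily e f" "polyfamily e g"
  shows "polyfamily e (\<lambda>x. f x * g x)"
  using assms(1)
proof induction
  case zero
  then show ?case by (simp add: polyfamily.zero)
next
  case (single \<phi> u)
  show ?case
    using assms(2)
  proof induction
    case zero
    then show ?case by (simp add: polyfamily.zero)
  next
    case (single \<psi> w)
    then show ?case
      using \<open>polyfun e \<phi>\<close> by (simp add: mult_single polyfamily.single polyfun_mult)
  next
    case (add f g)
    then show ?case by (simp add: distrib_left polyfamily.add)
  qed
next
  case (add f f')
  then show ?case by (simp add: distrib_right polyfamily.add)
qed

lemma polyfamily_const: "polyfun e \<phi> \<Longrightarrow> polyfamily e (\<lambda>x. const (\<phi> x))"
  unfolding const_def by (rule polyfamily.single)

lemma polyfamily_fixed: "polyfamily e (\<lambda>x. f)"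
proof (induction f rule: mpoly_induct)
  case (add u c f)
  then show ?case by (intro polyfamily.add polyfamily.single polyfun_const)
qed (rule polyfamily.zero)

lemma polyfamily_sum:
  "(\<And>i. i \<in> A \<Longrightarrow> polyfamily e (f i)) \<Longrightarrow> polyfamily e (\<lambda>x. \<Sum>i\<in>A. f i x)"
  by (induction A rule: infinite_finite_induct) (simp_all add: polyfamily.zero polyfamily.add)

lemma polyfamily_power: "polyfamily e f \<Longrightarrow> polyfamily e (\<lambda>x. f x ^ k)"
  by (induction k) (simp_all add: polyfamily_fixed polyfamily_mult)

lemma polyfamily_prod:
  "(\<And>i. i \<in> A \<Longrightarrow> polyfamily e (f i)) \<Longrightarrow> polyfamily e (\<lambda>x. \<Prod>i\<in>A. f i x)"
  by (induction A rule: infinite_finite_induct) (simp_all add: polyfamily_fixed polyfamily_mult)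

lemma polyfamily_lookup:
  "polyfamily e f \<Longrightarrow> polyfun e (\<lambda>x. Poly_Mapping.lookup (f x) w)"
proof (induction rule: polyfamily.induct)
  case (single \<phi> u)
  then show ?case by (cases "u = w") (auto simp: lookup_single when_def)
qed (simp_all add: polyfun_const lookup_add polyfun_add)

lemma polyfamily_change_vars:
  "polyfamily entries (\<lambda>g :: (('k::field, 'v::finite) vec, 'v) vec. change_vars g f)"
  unfolding change_vars_def subst_def
  by (intro polyfamily_sum polyfamily_mult polyfamily_prod polyfamily_power polyfamily_const
      polyfamily_fixed polyfun_const polyfun_entry)

text \<open>
  A matrix of polynomial functions that is triangular with nonzero diagonal at one point is
  nonsingular wherever a suitable polynomial function, itself nonzero at that point, does not
  vanish. The function is the product of the pivots of a fraction free Gaussian elimination.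
\<close>

lemma triangular_nonsingular:
  fixes c :: "'a::linorder \<Rightarrow> 'a \<Rightarrow> 'x \<Rightarrow> 'k::field"
  assumes "finite A"
    and "\<And>w w'. polyfun e (c w w')"
    and "\<And>w. w \<in> A \<Longrightarrow> c w w x0 \<noteq> 0"
    and "\<And>w w'. w \<in> A \<Longrightarrow> w' \<in> A \<Longrightarrow> w < w' \<Longrightarrow> c w w' x0 = 0"
  shows "\<exists>D. polyfun e D \<and> D x0 \<noteq> 0 \<and>
    (\<forall>x a. D x \<noteq> 0 \<longrightarrow> (\<forall>w'\<in>A. (\<Sum>w\<in>A. a w * c w w' x) = 0) \<longrightarrow> (\<forall>w\<in>A. a w = 0))"
  using assms
proof (induction A arbitrary: c rule: finite_linorder_max_induct)
  case empty
  show ?case by (rule exI[of _ "\<lambda>_. 1"]) auto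
next
  case (insert p A)
  \<comment> \<open>At \<open>x0\<close> the column of the largest index \<open>p\<close> vanishes off the diagonal, so there the
      elimination step merely rescales the other rows.\<close>
  define c' where "c' = (\<lambda>w w' x. c p p x * c w w' x - c w p x * c p w' x)"
  have pA: "w < p" if "w \<in> A" for w using insert.hyps that by auto
  have "\<exists>D. polyfun e D \<and> D x0 \<noteq> 0 \<and>
    (\<forall>x a. D x \<noteq> 0 \<longrightarrow> (\<forall>w'\<in>A. (\<Sum>w\<in>A. a w * c' w w' x) = 0) \<longrightarrow> (\<forall>w\<in>A. a w = 0))"
  proof (rule insert.IH)
    show "polyfun e (c' w w')" for w w'
      unfolding c'_def by (intro polyfun_diff polyfun_mult insert.prems)
    show "c' w w x0 \<noteq> 0" if "w \<in> A" for w
      using that pA insert.prems(2,3) by (simp add: c'_def)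
    show "c' w w' x0 = 0" if "w \<in> A" "w' \<in> A" "w < w'" for w w'
      using that pA insert.prems(2,3) by (simp add: c'_def)
  qed
  then obtain D where D: "polyfun e D" "D x0 \<noteq> 0"
    "\<And>x a. D x \<noteq> 0 \<Longrightarrow> \<forall>w'\<in>A. (\<Sum>w\<in>A. a w * c' w w' x) = 0 \<Longrightarrow> \<forall>w\<in>A. a w = 0"
    by blast
  show ?case
  proof (intro exI[of _ "\<lambda>x. c p p x * D x"] conjI allI impI)
    show "polyfun e (\<lambda>x. c p p x * D x)" by (intro polyfun_mult insert.prems D)
    show "c p p x0 * D x0 \<noteq> 0" using D(2) insert.prems(2) by simp
    fix x a
    assume nz: "c p p x * D x \<noteq> 0" and z0: "\<forall>w'\<in>insert p A. (\<Sum>w\<in>insert p A. a w * c w w' x) = 0"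
    have z: "(\<Sum>w\<in>A. a w * c w w' x) = - (a p * c p w' x)" if "w' \<in> insert p A" for w'
    proof -
      have "p \<notin> A" using pA by blast
      with insert.hyps(1) have "(\<Sum>w\<in>insert p A. a w * c w w' x) =
          a p * c p w' x + (\<Sum>w\<in>A. a w * c w w' x)"
        by (rule sum.insert)
      with bspec[OF z0 that] have "a p * c p w' x + (\<Sum>w\<in>A. a w * c w w' x) = 0"
        by simp
      then show ?thesis by (simp add: eq_neg_iff_add_eq_0 add.commute)
    qed
    have "\<forall>w\<in>A. a w = 0"
    proof (rule D(3)[OF _ ballI])
      show "D x \<noteq> 0" using nz by simp
      fix w' assume w': "w' \<in> A"
      have "(\<Sum>w\<in>A. a w * c' w w' x) =
          (\<Sum>w\<in>A. c p p x * (a w * c w w' x) - c p w' x * (a w * c w p x))"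
        by (rule sum.cong[OF refl]) (simp add: c'_def algebra_simps)
      also have "\<dots> = c p p x * (\<Sum>w\<in>A. a w * c w w' x) - c p w' x * (\<Sum>w\<in>A. a w * c w p x)"
        by (simp only: sum_subtractf sum_distrib_left)
      also have "\<dots> = 0" using w' by (simp add: z)
      finally show "(\<Sum>w\<in>A. a w * c' w w' x) = 0" .
    qed
    moreover from this have "a p * c p p x = 0" using z[of p] by simp
    ultimately show "\<forall>w\<in>insert p A. a w = 0" using nz by auto
  qed
qed

lemma finite_lead_set_homogeneous:
  fixes W :: "('v::{finite, linorder}, 'k::field) mpoly set"
  assumes "\<And>f. f \<in> W \<Longrightarrow> homogeneous t f"
  shows "lead_set W \<subseteq> {u. mdeg u = t}" "finite (lead_set W)"
proof -
  show "lead_set W \<subseteq> {u. mdeg u = t}"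
    using assms lead_monomial_in_keys unfolding lead_set_def homogeneous_def by blast
  then show "finite (lead_set W)" using finite_mdeg by (rule finite_subset)
qed

lemma eq_if_card_upper_eq:
  fixes A B :: "'a::linorder set"
  assumes fin: "finite A" "finite B"
    and eq: "\<And>u. u \<in> A \<union> B \<Longrightarrow> card {w \<in> A. u \<le> w} = card {w \<in> B. u \<le> w}"
  shows "A = B"
proof (rule ccontr)
  assume "A \<noteq> B"
  define C where "C = (A - B) \<union> (B - A)"
  have C: "finite C" "C \<noteq> {}" using fin \<open>A \<noteq> B\<close> by (auto simp: C_def)
  \<comment> \<open>At the largest element of the symmetric difference the two counts differ by one.\<close>
  define u where "u = Max C"
  have uC: "u \<in> C" using Max_in[OF C] by (simp add: u_def)
  have above: "w \<in> A \<longleftrightarrow> w \<in> B" if "u < w" for w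
  proof (rule ccontr)
    assume "\<not> ?thesis"
    then have "w \<in> C" by (auto simp: C_def)
    then have "w \<le> u" unfolding u_def using C(1) by (rule Max_ge[rotated])
    with that show False by simp
  qed
  have *: "card {w \<in> S. u \<le> w} = (if u \<in> S then 1 else 0) + card {w \<in> S. u < w}" if "finite S" for S
  proof -
    have "{w \<in> S. u \<le> w} = (if u \<in> S then insert u {w \<in> S. u < w} else {w \<in> S. u < w})"
      by (auto simp: le_less)
    then show ?thesis using that by simp
  qed
  have "{w \<in> A. u < w} = {w \<in> B. u < w}" using above by auto
  moreover have "card {w \<in> A. u \<le> w} = card {w \<in> B. u \<le> w}"
    using uC by (intro eq) (auto simp: C_def)
  ultimately have "u \<in> A \<longleftrightarrow> u \<in> B"
    unfolding *[OF fin(1)] *[OF fin(2)] by (simp split: if_splits)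
  with uC show False by (simp add: C_def)
qed

text \<open>
  Having at least as many leading monomials above \<open>u\<close> as at a given matrix is a generic property.
\<close>

lemma generic_card_lead_set_ge:
  fixes V :: "('v::{finite, linorder}, 'k::field) mpoly set"
  assumes V: "kspace.subspace V" "\<And>f. f \<in> V \<Longrightarrow> homogeneous t f" and g0: "invertible g0"
  shows "generic_mat (\<lambda>g. card {w \<in> lead_set (change_vars g0 ` V). u \<le> w}
                        \<le> card {w \<in> lead_set (change_vars g ` V). u \<le> w})"
proof -
  have fin: "finite (lead_set (change_vars g ` V))" for g :: "(('k, 'v) vec, 'v) vec"
    using V(2) by (intro finite_lead_set_homogeneous(2)[of _ t]) (auto intro: homogeneous_change_vars)
  define A where "A = {w \<in> lead_set (change_vars g0 ` V). u \<le> w}"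
  have "\<forall>w\<in>A. \<exists>f. f \<in> V \<and> change_vars g0 f \<noteq> 0 \<and> lead_monomial (change_vars g0 f) = w"
    by (auto simp: A_def lead_set_def)
  then obtain F where F: "\<And>w. w \<in> A \<Longrightarrow> F w \<in> V"
      "\<And>w. w \<in> A \<Longrightarrow> change_vars g0 (F w) \<noteq> 0"
      "\<And>w. w \<in> A \<Longrightarrow> lead_monomial (change_vars g0 (F w)) = w"
    by (metis (no_types, lifting))
  define c where "c = (\<lambda>w w' g. Poly_Mapping.lookup (change_vars g (F w)) w')"
  have "\<exists>D. polyfun entries D \<and> D g0 \<noteq> 0 \<and>
    (\<forall>x a. D x \<noteq> 0 \<longrightarrow> (\<forall>w'\<in>A. (\<Sum>w\<in>A. a w * c w w' x) = 0) \<longrightarrow> (\<forall>w\<in>A. a w = 0))"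
  proof (rule triangular_nonsingular)
    show "finite A" using fin[of g0] by (simp add: A_def)
    show "polyfun entries (c w w')" for w w'
      unfolding c_def by (intro polyfamily_lookup polyfamily_change_vars)
    show "c w w g0 \<noteq> 0" if "w \<in> A" for w
      using lead_monomial_in_keys[OF F(2)[OF that]] F(3)[OF that] by (simp add: c_def in_keys_iff)
    show "c w w' g0 = 0" if "w \<in> A" "w' \<in> A" "w < w'" for w w'
      using lead_monomial_ge[of w' "change_vars g0 (F w)"] F(3)[OF that(1)] that(3)
      by (force simp: c_def in_keys_iff)
  qed
  then obtain D where D: "polyfun entries D" "D g0 \<noteq> 0"
    "\<And>x a. D x \<noteq> 0 \<Longrightarrow> (\<forall>w'\<in>A. (\<Sum>w\<in>A. a w * c w w' x) = 0) \<Longrightarrow> \<forall>w\<in>A. a w = 0"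
    by blast
  show ?thesis
  proof (rule generic_matI[OF D(1) g0 D(2)])
    fix g :: "(('k, 'v) vec, 'v) vec" assume "invertible g" and Dg: "D g \<noteq> 0"
    show "card {w \<in> lead_set (change_vars g0 ` V). u \<le> w}
            \<le> card {w \<in> lead_set (change_vars g ` V). u \<le> w}"
      unfolding A_def[symmetric]
    proof (rule card_le_card_lead_set[of _ A u "\<lambda>w. change_vars g (F w)"])
      show "kspace.subspace (change_vars g ` V)" by (rule subspace_image_change_vars[OF V(1)])
      show "finite A" using fin[of g0] by (simp add: A_def)
      show "\<forall>w\<in>A. a w = 0"
        if "\<And>w'. w' \<in> A \<Longrightarrow> (\<Sum>w\<in>A. a w * Poly_Mapping.lookup (change_vars g (F w)) w') = 0" for a
        using D(3)[OF Dg] that by (simp add: c_def)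
    qed (use fin F in \<open>auto simp: A_def\<close>)
  qed
qed

text \<open>
  A matrix that maximizes the sum of these numbers over all \<open>u\<close> attains each of them
  generically, and the numbers determine the set of leading monomials.
\<close>

lemma generic_lead_set_homogeneous:
  fixes V :: "('v::{finite, linorder}, 'k::field) mpoly set"
  assumes inf: "infinite (UNIV :: 'k set)"
    and V: "kspace.subspace V" "\<And>f. f \<in> V \<Longrightarrow> homogeneous t f"
  shows "\<exists>M. generic_mat (\<lambda>g. lead_set (change_vars g ` V) = M)"
proof -
  let ?T = "{u :: 'v \<Rightarrow>\<^sub>0 nat. mdeg u = t}"
  let ?L = "\<lambda>g :: (('k, 'v) vec, 'v) vec. lead_set (change_vars g ` V)"
  let ?r = "\<lambda>u g. card {w \<in> ?L g. u \<le> w}"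
  have "homogeneous t f" if "f \<in> change_vars g ` V" for f and g :: "(('k, 'v) vec, 'v) vec"
    using that V(2) by (auto intro: homogeneous_change_vars)
  then have L: "?L g \<subseteq> ?T" "finite (?L g)" for g
    using finite_lead_set_homogeneous[of "change_vars g ` V" t] by blast+
  have "?r u g \<le> card ?T" for u g
    using L by (intro card_mono finite_mdeg) auto
  then have "(\<Sum>u\<in>?T. ?r u g) \<le> (\<Sum>u\<in>?T. card ?T)" for g by (intro sum_mono)
  then have "\<forall>g. invertible g \<longrightarrow> (\<Sum>u\<in>?T. ?r u g) < Suc (\<Sum>u\<in>?T. card ?T)"
    by (auto simp: less_Suc_eq_le)
  moreover have "invertible (mat 1 :: (('k, 'v) vec, 'v) vec)" by (auto simp: invertible_def)
  ultimately have "\<exists>g. invertible g \<and> (\<forall>g'. invertible g' \<longrightarrow> (\<Sum>u\<in>?T. ?r u g') \<le> (\<Sum>u\<in>?T. ?r u g))"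
    by (intro ex_has_greatest_nat)
  then obtain g0 where g0: "invertible g0"
      "\<And>g. invertible g \<Longrightarrow> (\<Sum>u\<in>?T. ?r u g) \<le> (\<Sum>u\<in>?T. ?r u g0)"
    by blast
  have "generic_mat (\<lambda>g. \<forall>u\<in>?T. ?r u g0 \<le> ?r u g)"
    by (intro generic_mat_ball inf finite_mdeg generic_card_lead_set_ge[of V t] V g0)
  then have "generic_mat (\<lambda>g. ?L g = ?L g0)"
  proof (rule generic_mat_mono)
    fix g :: "(('k, 'v) vec, 'v) vec" assume g: "invertible g" and le: "\<forall>u\<in>?T. ?r u g0 \<le> ?r u g"
    have eq: "?r u g = ?r u g0" if "u \<in> ?T" for u
    proof (rule ccontr)
      assume "?r u g \<noteq> ?r u g0"
      with bspec[OF le that] have "?r u g0 < ?r u g" by linarith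
      with that have "\<exists>u\<in>?T. ?r u g0 < ?r u g" by (rule bexI[rotated])
      with le have "(\<Sum>u\<in>?T. ?r u g0) < (\<Sum>u\<in>?T. ?r u g)"
        by (intro sum_strict_mono_ex1 finite_mdeg) auto
      with g0(2)[OF g] show False by simp
    qed
    show "?L g = ?L g0"
      using L by (intro eq_if_card_upper_eq eq) auto
  qed
  then show ?thesis by blast
qed

text \<open>The subsequence consists of the indices whose value is minimal among all later values.\<close>

lemma nat_seq_mono_subseq:
  fixes f :: "nat \<Rightarrow> nat"
  shows "\<exists>r :: nat \<Rightarrow> nat. strict_mono r \<and> mono (f \<circ> r)"
proof -
  let ?P = "{k. \<forall>k'\<ge>k. f k \<le> f k'}"
  have "\<exists>k\<ge>N. k \<in> ?P" for N
  proof -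
    obtain k where "N \<le> k" "\<And>k'. N \<le> k' \<Longrightarrow> f k \<le> f k'"
      using ex_has_least_nat[of "\<lambda>k. N \<le> k" N f] by auto
    then show ?thesis by (intro exI[of _ k]) auto
  qed
  then have inf: "infinite ?P" by (auto simp: infinite_nat_iff_unbounded_le)
  have sm: "strict_mono (enumerate ?P)" using inf by (rule strict_mono_enumerate)
  show ?thesis
  proof (intro exI conjI, rule sm)
    show "mono (f \<circ> enumerate ?P)"
    proof (rule monoI)
      fix i j :: nat assume "i \<le> j"
      then have "enumerate ?P i \<le> enumerate ?P j"
        using sm by (simp add: strict_mono_less_eq)
      moreover have "enumerate ?P i \<in> ?P" using inf by (rule enumerate_in_set)
      ultimately show "(f \<circ> enumerate ?P) i \<le> (f \<circ> enumerate ?P) j" by simp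
    qed
  qed
qed

lemma monomial_seq_mono:
  fixes f :: "nat \<Rightarrow> ('v::finite \<Rightarrow>\<^sub>0 nat)"
  shows "\<exists>r :: nat \<Rightarrow> nat. strict_mono r \<and> (\<forall>v. mono (\<lambda>k. Poly_Mapping.lookup (f (r k)) v))"
proof -
  have "\<exists>r :: nat \<Rightarrow> nat. strict_mono r \<and> (\<forall>v\<in>A. mono (\<lambda>k. Poly_Mapping.lookup (f (r k)) v))" for A
    using finite[of A]
  proof induction
    case empty
    show ?case by (rule exI[of _ id]) (auto simp: strict_mono_def)
  next
    case (insert v A)
    then obtain r :: "nat \<Rightarrow> nat" where r: "strict_mono r" "\<forall>v\<in>A. mono (\<lambda>k. Poly_Mapping.lookup (f (r k)) v)"
      by blast
    obtain s :: "nat \<Rightarrow> nat" where s: "strict_mono s" "mono ((\<lambda>k. Poly_Mapping.lookup (f (r k)) v) \<circ> s)"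
      using nat_seq_mono_subseq[of "\<lambda>k. Poly_Mapping.lookup (f (r k)) v"] by blast
    have "mono s" using s(1) by (rule strict_mono_mono)
    then have "mono (\<lambda>k. Poly_Mapping.lookup (f (r (s k))) v')" if "v' \<in> A" for v'
      using r(2) that by (auto simp: mono_def)
    then show ?case
      using s r(1) by (intro exI[of _ "r \<circ> s"]) (auto simp: strict_mono_def o_def)
  qed
  from this[of UNIV] show ?thesis by simp
qed

text \<open>Dickson's lemma: the minimal elements of a set of monomials have bounded degree.\<close>

lemma dickson:
  fixes S :: "('v::finite \<Rightarrow>\<^sub>0 nat) set"
  shows "\<exists>D. \<forall>u\<in>S. \<exists>w\<in>S. mdeg w \<le> D \<and> (\<exists>z. u = z + w)"
proof (rule ccontr)
  assume "\<not> ?thesis"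
  then have "\<forall>D. \<exists>u. u \<in> S \<and> (\<forall>w\<in>S. mdeg w \<le> D \<longrightarrow> (\<forall>z. u \<noteq> z + w))" by blast
  then obtain f where f: "\<And>D. f D \<in> S" "\<And>D w z. w \<in> S \<Longrightarrow> mdeg w \<le> D \<Longrightarrow> f D \<noteq> z + w"
    by metis
  obtain r :: "nat \<Rightarrow> nat" where r: "strict_mono r" "\<And>v. mono (\<lambda>k. Poly_Mapping.lookup (f (r k)) v)"
    using monomial_seq_mono[of f] by blast
  define k where "k = mdeg (f (r 0))"
  have "f (r k) = (f (r k) - f (r 0)) + f (r 0)"
    using r(2) by (intro poly_mapping_eqI) (simp add: lookup_add lookup_minus mono_def)
  moreover have "mdeg (f (r 0)) \<le> r k"
    using strict_mono_imp_increasing[OF r(1)] by (simp add: k_def)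
  ultimately show False using f(2)[OF f(1)] by blast
qed

lemma card_lead_set_image:
  fixes I :: "('v::{finite, linorder}, 'k::field) mpoly set"
  assumes I: "graded_ideal I" and g: "invertible g"
  shows "card {u \<in> lead_set (change_vars g ` I). mdeg u = t} = kdim (component I t)"
proof -
  have ideal: "is_ideal I" using I by (simp add: graded_ideal_def)
  have "card (lead_set (change_vars g ` component I t)) = kdim (change_vars g ` component I t)"
    by (intro kdim_eq_card_lead_set[symmetric] subspace_image_change_vars component_subspace ideal
        finite_lead_set_homogeneous(2)[of _ t])
       (auto simp: component_def homogeneous_change_vars)
  then show ?thesis
    by (simp add: lead_set_component[OF graded_ideal_image_change_vars[OF I g], symmetric]
        component_image_change_vars[OF g] kdim_image_change_vars[OF g])
qed

text \<open>
  The generic sets of leading monomials in the single degrees form a set closed under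
  multiplication by monomials, so by Dickson's lemma a matrix that is generic in finitely many
  degrees has at least these leading monomials, and dimensions leave no room for more.
\<close>

lemma generic_lead_set:
  fixes I :: "('v::{finite, linorder}, 'k::field) mpoly set"
  assumes inf: "infinite (UNIV :: 'k set)" and I: "graded_ideal I"
  shows "\<exists>J. generic_mat (\<lambda>g. lead_set (change_vars g ` I) = J)"
proof -
  have ideal: "is_ideal I" using I by (simp add: graded_ideal_def)
  let ?L = "\<lambda>t (g :: (('k, 'v) vec, 'v) vec). {u \<in> lead_set (change_vars g ` I). mdeg u = t}"
  have L: "?L t g = lead_set (change_vars g ` component I t)" if "invertible g" for t g
    using lead_set_component[OF graded_ideal_image_change_vars[OF I that]]
    by (simp add: component_image_change_vars[OF that])
  note card_L = card_lead_set_image[OF I]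
  have "\<exists>M. generic_mat (\<lambda>g. lead_set (change_vars g ` component I t) = M)" for t
    by (rule generic_lead_set_homogeneous[OF inf component_subspace[OF ideal]])
       (auto simp: component_def)
  then obtain M where "\<And>t. generic_mat (\<lambda>g. lead_set (change_vars g ` component I t) = M t)"
    by metis
  then have M: "generic_mat (\<lambda>g. ?L t g = M t)" for t
    by (rule generic_mat_mono) (simp add: L)
  define J where "J = {u. u \<in> M (mdeg u)}"
  obtain D where D: "\<And>u. u \<in> J \<Longrightarrow> \<exists>w\<in>J. mdeg w \<le> D \<and> (\<exists>z. u = z + w)"
    using dickson[of J] by blast
  have "generic_mat (\<lambda>g. \<forall>t\<in>{..D}. ?L t g = M t)"
    using M by (intro generic_mat_ball[OF inf]) auto
  then have "generic_mat (\<lambda>g. lead_set (change_vars g ` I) = J)"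
  proof (rule generic_mat_mono)
    fix g :: "(('k, 'v) vec, 'v) vec" assume g: "invertible g" and D': "\<forall>t\<in>{..D}. ?L t g = M t"
    have sub: "J \<subseteq> lead_set (change_vars g ` I)"
    proof
      fix u assume "u \<in> J"
      then obtain w z where w: "w \<in> J" "mdeg w \<le> D" "u = z + w" using D by blast
      then have "w \<in> lead_set (change_vars g ` I)" using D' by (auto simp: J_def)
      then show "u \<in> lead_set (change_vars g ` I)"
        unfolding w(3) by (rule lead_set_add[OF is_ideal_image_change_vars[OF ideal g]])
    qed
    have "?L t g = M t" for t
    proof -
      obtain g' where g': "invertible g'" "?L t g' = M t" using generic_mat_ex[OF M] by blast
      then have "M t \<subseteq> J" by (auto simp: J_def)
      with sub g' have "M t \<subseteq> ?L t g" by auto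
      moreover have "finite (?L t g)" by (rule finite_subset[OF _ finite_mdeg[of t]]) auto
      moreover have "card (M t) = card (?L t g)" using card_L[OF g] card_L[OF g'(1)] g'(2) by metis
      ultimately show ?thesis by (metis card_subset_eq)
    qed
    then show "lead_set (change_vars g ` I) = J" by (auto simp: J_def)
  qed
  then show ?thesis by blast
qed

lemma gin_eq:
  fixes I :: "('v::{finite, linorder}, 'k::field) mpoly set"
  assumes inf: "infinite (UNIV :: 'k set)" and I: "is_ideal I"
    and J: "generic_mat (\<lambda>g. lead_set (change_vars g ` I) = J)"
  shows "gin I = supported J"
  unfolding gin_def
proof (rule the_equality)
  have init: "initial_ideal (change_vars g ` I) = supported (lead_set (change_vars g ` I))"
    if "invertible g" for g
    by (rule initial_ideal_eq[OF is_ideal_image_change_vars[OF I that]])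
  show "for_general_change (\<lambda>g. initial_ideal (change_vars g ` I) = supported J)"
    unfolding generic_mat_iff using J by (rule generic_mat_mono) (simp add: init)
  show "J' = supported J"
    if "for_general_change (\<lambda>g. initial_ideal (change_vars g ` I) = J')" for J'
    using generic_mat_ex[OF generic_mat_conj[OF inf that[unfolded generic_mat_iff] J]]
    by (auto simp: init)
qed

section \<open>Powers of the ideal of a point\<close>

text \<open>The largest variable, and the degree of a monomial in all the other variables.\<close>

definition first_var :: "'v::{finite, linorder}" where
  "first_var = Min UNIV"

definition tail_deg :: "('v::{finite, linorder} \<Rightarrow>\<^sub>0 nat) \<Rightarrow> nat" where
  "tail_deg u = (\<Sum>i\<in>UNIV - {first_var}. Poly_Mapping.lookup u i)"

lemma mdeg_eq_tail_deg: "mdeg u = Poly_Mapping.lookup u first_var + tail_deg u"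
  unfolding mdeg_UNIV tail_deg_def by (rule sum.remove) auto

lemma tail_deg_add: "tail_deg (u + w) = tail_deg u + tail_deg w"
  by (simp add: tail_deg_def lookup_add sum.distrib)

lemma lookup_first_var_mono:
  assumes "u \<le> w"
  shows "Poly_Mapping.lookup u first_var \<le> Poly_Mapping.lookup w first_var"
proof (cases "u = w")
  case False
  with assms have "less_fun (Poly_Mapping.lookup u) (Poly_Mapping.lookup w)"
    by (simp add: less_poly_mapping.rep_eq[symmetric])
  then obtain k where k: "Poly_Mapping.lookup u k < Poly_Mapping.lookup w k"
      "\<And>k'. k' < k \<Longrightarrow> Poly_Mapping.lookup u k' = Poly_Mapping.lookup w k'"
    unfolding less_fun_def by blast
  have "first_var \<le> k" unfolding first_var_def by (rule Min_le) auto
  with k show ?thesis by (cases "first_var = k") auto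
qed simp

text \<open>A representative of the point \<open>(1 : 0 : \<dots> : 0)\<close>.\<close>

definition first_point :: "('k::field, 'v::{finite, linorder}) vec" where
  "first_point = axis first_var 1"

lemma monom_value_first_point:
  "monom_value (($) (first_point :: ('k::field, 'v::{finite, linorder}) vec)) u =
    (if tail_deg u = 0 then 1 else 0)"
proof -
  have "monom_value (($) (first_point :: ('k, 'v) vec)) u =
      (\<Prod>i\<in>UNIV - {first_var}. ($) (first_point :: ('k, 'v) vec) i ^ Poly_Mapping.lookup u i)"
    unfolding monom_value_def by (simp add: prod.remove[of UNIV first_var] first_point_def)
  also have "\<dots> = (\<Prod>i\<in>UNIV - {first_var}. if Poly_Mapping.lookup u i = 0 then 1 else 0)"
    by (rule prod.cong) (auto simp: first_point_def axis_def)
  also have "\<dots> = (if tail_deg u = 0 then 1 else 0)"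
    by (auto simp: tail_deg_def)
  finally show ?thesis .
qed

lemma single_first_var:
  assumes "tail_deg u = 0"
  shows "u = Poly_Mapping.single first_var (mdeg u)"
proof (rule poly_mapping_eqI)
  fix i
  show "Poly_Mapping.lookup u i = Poly_Mapping.lookup (Poly_Mapping.single first_var (mdeg u)) i"
    using assms by (cases "i = first_var")
      (auto simp: mdeg_eq_tail_deg lookup_single tail_deg_def when_def)
qed

lemma point_ideal_first_point:
  "point_ideal first_point = (supported {u. 1 \<le> tail_deg u} ::
     ('v::{finite, linorder}, 'k::field) mpoly set)" (is "_ = ?E")
proof
  have "f \<in> ?E" if f: "homogeneous d f" "peval (($) first_point) f = 0" for d f
  proof -
    have "Poly_Mapping.lookup f u = 0" if u: "tail_deg u = 0" for u
    proof (rule ccontr)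
      assume nz: "Poly_Mapping.lookup f u \<noteq> 0"
      then have uk: "u \<in> Poly_Mapping.keys f" by (simp add: in_keys_iff)
      have "tail_deg w \<noteq> 0" if "w \<in> Poly_Mapping.keys f - {u}" for w
        using single_first_var[of w] single_first_var[OF u] that uk f(1)
        by (auto simp: homogeneous_def)
      then have "(\<Sum>w\<in>Poly_Mapping.keys f - {u}. Poly_Mapping.lookup f w *
          monom_value (($) (first_point :: ('k, 'v) vec)) w) = 0"
        by (intro sum.neutral ballI) (simp only: monom_value_first_point if_False mult_zero_right)
      then have "peval (($) first_point) f = Poly_Mapping.lookup f u"
        unfolding peval_def subst_def monom_value_keys
        using uk u by (simp add: sum.remove[of _ u] monom_value_first_point)
      with f(2) nz show False by simp
    qed
    then show ?thesis by (force simp: supported_def in_keys_iff Suc_le_eq)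
  qed
  moreover have "is_ideal ?E"
    by (rule supported_is_ideal) (auto simp: tail_deg_add)
  ultimately show "point_ideal first_point \<subseteq> ?E"
    unfolding point_ideal_def by (intro ideal_gen_least) auto
  show "?E \<subseteq> point_ideal first_point"
    unfolding point_ideal_def
  proof (rule supported_subset_ideal[OF ideal_gen_is_ideal], rule subsetD[OF ideal_gen_superset])
    fix u :: "'v \<Rightarrow>\<^sub>0 nat" assume "u \<in> {u. 1 \<le> tail_deg u}"
    then have "peval (($) (first_point :: ('k, 'v) vec)) (mono_poly u) = 0"
      by (simp add: mono_poly_def peval_def subst_single[OF rhom_id] monom_value_first_point)
    then show "mono_poly u \<in> {f. (\<exists>d. homogeneous d f) \<and>
        peval (($) (first_point :: ('k, 'v) vec)) f = 0}"
      by (auto simp: mono_poly_def homogeneous_def)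
  qed
qed

text \<open>Forms vanishing to order \<open>m\<close> at the first coordinate point.\<close>

lemma ideal_power_first_point:
  "ideal_power (point_ideal first_point) m = (supported {u. m \<le> tail_deg u} ::
     ('v::{finite, linorder}, 'k::field) mpoly set)"
proof (induction m)
  case 0
  then show ?case by (auto simp: supported_def)
next
  case (Suc m)
  let ?E = "\<lambda>m. supported {u. m \<le> tail_deg u} :: ('v, 'k) mpoly set"
  let ?G = "{f * g | f g. f \<in> ?E 1 \<and> g \<in> ?E m}"
  have "f * g \<in> ?E (Suc m)" if fg: "f \<in> ?E 1" "g \<in> ?E m" for f g
    unfolding supported_def
  proof (clarify)
    fix w assume "w \<in> Poly_Mapping.keys (f * g)"
    then obtain u v where "w = u + v" "u \<in> Poly_Mapping.keys f" "v \<in> Poly_Mapping.keys g"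
      using keys_mult[of f g] by blast
    with fg show "Suc m \<le> tail_deg w"
      by (fastforce simp: supported_def tail_deg_add)
  qed
  moreover have "is_ideal (?E (Suc m))"
    by (rule supported_is_ideal) (auto simp: tail_deg_add)
  ultimately have 1: "ideal_gen ?G \<subseteq> ?E (Suc m)"
    by (intro ideal_gen_least) auto
  have 2: "?E (Suc m) \<subseteq> ideal_gen ?G"
  proof (rule supported_subset_ideal[OF ideal_gen_is_ideal], rule subsetD[OF ideal_gen_superset])
    fix u :: "'v \<Rightarrow>\<^sub>0 nat" assume u: "u \<in> {u. Suc m \<le> tail_deg u}"
    then obtain i where i: "i \<noteq> first_var" "Poly_Mapping.lookup u i \<noteq> 0"
      by (metis (mono_tags, lifting) DiffE Suc_le_eq gr_implies_not_zero insertI1 mem_Collect_eq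
          sum.neutral tail_deg_def)
    have u_eq: "u = Poly_Mapping.single i 1 + (u - Poly_Mapping.single i 1)"
      using i by (intro poly_mapping_eqI) (auto simp: lookup_add lookup_minus lookup_single when_def)
    have ti: "tail_deg (Poly_Mapping.single i 1) = 1"
      using mdeg_eq_tail_deg[of "Poly_Mapping.single i 1"] i by (simp add: lookup_single)
    have "tail_deg u = 1 + tail_deg (u - Poly_Mapping.single i 1)"
      by (subst u_eq) (simp only: tail_deg_add ti)
    then have "mono_poly (u - Poly_Mapping.single i 1) \<in> ?E m" "mono_poly (Poly_Mapping.single i 1) \<in> ?E 1"
      using u ti by (auto simp: supported_def mono_poly_def)
    moreover have "mono_poly u = (mono_poly (Poly_Mapping.single i 1) *
        mono_poly (u - Poly_Mapping.single i 1) :: ('v, 'k) mpoly)"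
      using u_eq by (simp add: mono_poly_def mult_single)
    ultimately show "mono_poly u \<in> ?G" by blast
  qed
  from 1 2 show ?case
    unfolding ideal_power.simps Suc.IH unfolding point_ideal_first_point by simp
qed

lemma image_change_vars_ideal_gen:
  assumes g: "invertible g"
  shows "change_vars g ` ideal_gen B = ideal_gen (change_vars g ` B)"
proof
  let ?J = "{f. change_vars g f \<in> ideal_gen (change_vars g ` B)}"
  have "is_ideal ?J"
    using ideal_gen_is_ideal[of "change_vars g ` B"]
    by (simp add: is_ideal_iff change_vars_add change_vars_mult change_vars_zero)
  moreover have "B \<subseteq> ?J" using ideal_gen_superset[of "change_vars g ` B"] by auto
  ultimately have "ideal_gen B \<subseteq> ?J" by (intro ideal_gen_least)
  then show "change_vars g ` ideal_gen B \<subseteq> ideal_gen (change_vars g ` B)" by auto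
  show "ideal_gen (change_vars g ` B) \<subseteq> change_vars g ` ideal_gen B"
    using g ideal_gen_superset[of B]
    by (intro ideal_gen_least is_ideal_image_change_vars ideal_gen_is_ideal) auto
qed

lemma image_change_vars_ideal_power:
  assumes g: "invertible g"
  shows "change_vars g ` ideal_power I m = ideal_power (change_vars g ` I) m"
proof (induction m)
  case 0
  then show ?case using bij_change_vars[OF g] by (simp add: bij_is_surj)
next
  case (Suc m)
  have "change_vars g ` {f * h | f h. f \<in> I \<and> h \<in> ideal_power I m} =
      {f * h | f h. f \<in> change_vars g ` I \<and> h \<in> change_vars g ` ideal_power I m}"
    by (force simp: change_vars_mult image_iff)
  then show ?case by (simp add: image_change_vars_ideal_gen[OF g] Suc.IH)
qed

lemma image_change_vars_point_ideal:
  assumes g: "invertible g"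
  shows "change_vars g ` point_ideal (g *v a) = point_ideal a"
proof -
  obtain h where h: "\<And>f. change_vars g (change_vars h f) = f"
    using change_vars_inverse[OF g] by metis
  have "change_vars g ` {f. (\<exists>d. homogeneous d f) \<and> peval (($) (g *v a)) f = 0} =
      {f. (\<exists>d. homogeneous d f) \<and> peval (($) a) f = 0}"
  proof (intro equalityI subsetI)
    fix f assume "f \<in> {f. (\<exists>d. homogeneous d f) \<and> peval (($) a) f = 0}"
    then have "(\<exists>d. homogeneous d (change_vars h f)) \<and> peval (($) (g *v a)) (change_vars h f) = 0"
      by (auto simp: h simp flip: peval_change_vars intro: homogeneous_change_vars)
    then show "f \<in> change_vars g ` {f. (\<exists>d. homogeneous d f) \<and> peval (($) (g *v a)) f = 0}"
      by (intro image_eqI[of _ _ "change_vars h f"]) (auto simp: h)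
  qed (auto simp: peval_change_vars intro: homogeneous_change_vars)
  then show ?thesis
    unfolding point_ideal_def image_change_vars_ideal_gen[OF g] by simp
qed

text \<open>
  In the lexicographic order the leading monomial of a form has the least degree in the
  variables other than the first one. So vanishing to order \<open>m\<close> at the first coordinate point
  is a condition on the leading monomial alone.
\<close>

lemma kdim_fat_point:
  fixes I :: "('v::{finite, linorder}, 'k::field) mpoly set"
  assumes I: "graded_ideal I" and g: "invertible g"
  shows "kdim (component (I \<inter> ideal_power (point_ideal (g *v first_point)) m) t) =
    card {u \<in> lead_set (change_vars g ` I). mdeg u = t \<and> m \<le> tail_deg u}"
proof -
  let ?J = "change_vars g ` I"
  let ?E = "supported {u. m \<le> tail_deg u} :: ('v, 'k) mpoly set"
  let ?W = "component (?J \<inter> ?E) t"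
  have J: "graded_ideal ?J" by (rule graded_ideal_image_change_vars[OF I g])
  have inj: "inj (change_vars g)" using bij_change_vars[OF g] by (rule bij_is_inj)
  have "change_vars g ` component (I \<inter> ideal_power (point_ideal (g *v first_point)) m) t = ?W"
    by (simp add: component_image_change_vars[OF g, symmetric] image_Int[OF inj]
        image_change_vars_ideal_power[OF g] image_change_vars_point_ideal[OF g]
        ideal_power_first_point)
  then have "kdim (component (I \<inter> ideal_power (point_ideal (g *v first_point)) m) t) = kdim ?W"
    using kdim_image_change_vars[OF g] by metis
  also have "\<dots> = card (lead_set ?W)"
  proof (rule kdim_eq_card_lead_set)
    have "?W = component ?J t \<inter> ?E" by (auto simp: component_def)
    moreover have "kspace.subspace (component ?J t)"
      using J by (intro component_subspace) (simp add: graded_ideal_def)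
    ultimately show "kspace.subspace ?W"
      using kspace.subspace_inter supported_subspace by metis
    show "finite (lead_set ?W)"
      by (rule finite_lead_set_homogeneous(2)[of _ t]) (simp add: component_def)
  qed
  also have "lead_set ?W = {u \<in> lead_set ?J. mdeg u = t \<and> m \<le> tail_deg u}"
  proof (intro equalityI subsetI)
    fix u assume "u \<in> lead_set ?W"
    then obtain f where f: "f \<in> ?J" "f \<in> ?E" "homogeneous t f" "f \<noteq> 0" "u = lead_monomial f"
      by (auto simp: lead_set_def component_def)
    have "u \<in> Poly_Mapping.keys f" using f lead_monomial_in_keys by blast
    with f show "u \<in> {u \<in> lead_set ?J. mdeg u = t \<and> m \<le> tail_deg u}"
      by (auto simp: lead_setI homogeneous_def supported_def)
  next
    fix u assume u: "u \<in> {u \<in> lead_set ?J. mdeg u = t \<and> m \<le> tail_deg u}"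
    then have "u \<in> lead_set (component ?J t)" by (simp add: lead_set_component[OF J])
    then obtain f where f: "f \<in> ?J" "homogeneous t f" "f \<noteq> 0" "u = lead_monomial f"
      by (auto simp: lead_set_def component_def)
    have "f \<in> ?E"
      unfolding supported_def
    proof (clarify)
      fix w assume w: "w \<in> Poly_Mapping.keys f"
      have "Poly_Mapping.lookup w first_var \<le> Poly_Mapping.lookup u first_var"
        unfolding f(4) by (intro lookup_first_var_mono lead_monomial_ge w)
      moreover have "mdeg w = mdeg u" using u w f(2) by (simp add: homogeneous_def)
      ultimately show "m \<le> tail_deg w" using u by (simp add: mdeg_eq_tail_deg)
    qed
    with f have "f \<in> ?W" by (simp add: component_def)
    with f show "u \<in> lead_set ?W" by (auto intro: lead_setI)
  qed
  finally show ?thesis .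
qed

section \<open>General points\<close>

lemma polyfun_point_coord: "polyfun ($) (\<lambda>a. a $ i)"
  by (rule polyfun_coord)

lemma for_general_point_common:
  fixes Q Q' :: "('k::field, 'v::finite) vec \<Rightarrow> bool"
  assumes inf: "infinite (UNIV :: 'k set)"
    and "for_general_point Q" "for_general_point Q'"
  shows "\<exists>a. Q a \<and> Q' a"
proof -
  have *: "\<exists>\<phi>. polyfun ($) \<phi> \<and> (\<exists>a. \<phi> a \<noteq> 0) \<and> (\<forall>a. \<phi> a \<noteq> 0 \<longrightarrow> Q a)"
    if general: "for_general_point Q" for Q :: "('k, 'v) vec \<Rightarrow> bool"
  proof -
    obtain S F a where F: "F \<in> S" "peval (($) a) F \<noteq> 0" "a \<noteq> 0"
      and Q: "\<And>a. a \<noteq> 0 \<Longrightarrow> \<exists>F\<in>S. peval (($) a) F \<noteq> 0 \<Longrightarrow> Q a"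
      using general unfolding for_general_point_def zariski_open_proj_def by blast
    obtain i where i: "a $ i \<noteq> 0" using F(3) by (auto simp: vec_eq_iff)
    \<comment> \<open>The coordinate factor excludes the zero vector, which is not a point.\<close>
    show ?thesis
    proof (intro exI[of _ "\<lambda>b. b $ i * peval (($) b) F"] conjI allI impI)
      show "polyfun ($) (\<lambda>b. b $ i * peval (($) b) F)"
        by (intro polyfun_mult polyfun_peval polyfun_point_coord)
      show "\<exists>b. b $ i * peval (($) b) F \<noteq> 0" using F i by (intro exI[of _ a]) simp
      show "Q b" if "b $ i * peval (($) b) F \<noteq> 0" for b
        using that F(1) by (intro Q) auto
    qed
  qed
  obtain \<phi> a where 1: "polyfun ($) \<phi>" "\<phi> a \<noteq> 0" "\<And>a. \<phi> a \<noteq> 0 \<Longrightarrow> Q a"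
    using *[OF assms(2)] by blast
  obtain \<psi> b where 2: "polyfun ($) \<psi>" "\<psi> b \<noteq> 0" "\<And>a. \<psi> a \<noteq> 0 \<Longrightarrow> Q' a"
    using *[OF assms(3)] by blast
  define l where "l = (\<lambda>s. \<chi> i. a $ i + s * (b $ i - a $ i))"
  obtain s where "\<phi> (l s) \<noteq> 0" "\<psi> (l s) \<noteq> 0"
  proof (rule polyfun_common_nonzero[OF inf 1(1) 2(1) 1(2) 2(2), of l])
    show "l 0 = a" "l 1 = b" by (simp_all add: l_def vec_eq_iff)
  qed (auto simp: l_def)
  with 1(3) 2(3) show ?thesis by blast
qed

lemma peval_scaled:
  assumes "homogeneous d f"
  shows "peval (($) (s *s a)) f = s ^ d * peval (($) a) f"
proof -
  have "monom_value (($) (s *s a)) u = s ^ mdeg u * monom_value (($) a) u" for u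
    by (simp add: monom_value_def power_mult_distrib prod.distrib mdeg_UNIV power_sum)
  note scaled = this
  have "peval (($) (s *s a)) f =
      (\<Sum>u\<in>Poly_Mapping.keys f. s ^ d * (Poly_Mapping.lookup f u * monom_value (($) a) u))"
    unfolding peval_def subst_def monom_value_keys
    unfolding scaled using assms by (intro sum.cong) (auto simp: homogeneous_def)
  then show ?thesis
    unfolding peval_def subst_def monom_value_keys by (simp only: sum_distrib_left)
qed

lemma point_ideal_scaled:
  assumes "s \<noteq> 0" shows "point_ideal (s *s a) = point_ideal a"
proof -
  have "{f. (\<exists>d. homogeneous d f) \<and> peval (($) (s *s a)) f = 0} =
      {f. (\<exists>d. homogeneous d f) \<and> peval (($) a) f = 0}"
    using assms by (auto simp: peval_scaled)
  then show ?thesis by (simp add: point_ideal_def)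
qed

lemma hom_part_decompose:
  "f = (\<Sum>d\<in>mdeg ` Poly_Mapping.keys f. hom_part d f)"
proof (rule poly_mapping_eqI)
  fix u
  show "Poly_Mapping.lookup f u =
      Poly_Mapping.lookup (\<Sum>d\<in>mdeg ` Poly_Mapping.keys f. hom_part d f) u"
    by (cases "u \<in> Poly_Mapping.keys f")
       (auto simp: lookup_sum lookup_hom_part in_keys_iff sum.delta)
qed

text \<open>
  A property of points that holds for the image of the first coordinate point under a generic
  matrix holds for a general point: let the first column of a suitable matrix vary. The
  resulting condition need not be homogeneous, but by invariance under rescaling it may be
  replaced by the nonvanishing of one of its homogeneous parts.
\<close>

lemma for_general_pointI:
  fixes Q :: "('k::field, 'v::{finite, linorder}) vec \<Rightarrow> bool"
  assumes inf: "infinite (UNIV :: 'k set)"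
    and gen: "generic_mat (\<lambda>g. Q (g *v first_point))"
    and inv: "\<And>s a. s \<noteq> 0 \<Longrightarrow> Q (s *s a) \<Longrightarrow> Q a"
  shows "for_general_point Q"
proof -
  obtain F and g0 :: "(('k, 'v) vec, 'v) vec" where F: "peval (entries g0) F \<noteq> 0"
      "\<And>g. peval (entries g) F \<noteq> 0 \<Longrightarrow> invertible g \<and> Q (g *v first_point)"
    using gen unfolding generic_mat_def polyfun_def by auto
  define mat_of :: "('k, 'v) vec \<Rightarrow> (('k, 'v) vec, 'v) vec" where
    "mat_of = (\<lambda>a. \<chi> i j. if j = first_var then a $ i else g0 $ i $ j)"
  have column: "g *v first_point = (\<chi> i. g $ i $ first_var)" for g :: "(('k, 'v) vec, 'v) vec"
    by (simp add: vec_eq_iff matrix_vector_mult_def first_point_def axis_def if_distrib cong: if_cong)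
  have mat_of_point: "mat_of a *v first_point = a" for a
    by (simp add: column mat_of_def vec_eq_iff)
  have nonzero: "g *v first_point \<noteq> 0" if g: "invertible g" for g :: "(('k, 'v) vec, 'v) vec"
  proof
    assume *: "g *v first_point = 0"
    obtain h where "h ** g = mat 1" using g by (auto simp: invertible_def)
    then have "h *v (g *v first_point) = first_point"
      by (simp add: matrix_vector_mul_assoc)
    then have "(first_point :: ('k, 'v) vec) = 0" by (simp add: *)
    then have "(first_point :: ('k, 'v) vec) $ first_var = 0" by simp
    then show False by (simp add: first_point_def)
  qed
  define a0 where "a0 = g0 *v first_point"
  have "mat_of a0 = g0" by (simp add: a0_def mat_of_def column vec_eq_iff)
  define H :: "('v, 'k) mpoly" where
    "H = subst const (\<lambda>(i, j). if j = first_var then xvar i else const (g0 $ i $ j)) F"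
  have H: "peval (($) a) H = peval (entries (mat_of a)) F" for a
  proof -
    have "(\<lambda>x. peval (($) a) (case x of (i, j) \<Rightarrow> if j = first_var then xvar i else const (g0 $ i $ j)))
        = entries (mat_of a)"
      by (auto simp: fun_eq_iff mat_of_def)
    then show ?thesis
      unfolding H_def by (simp add: rhom_subst_compose[OF rhom_peval] peval_def[of "entries (mat_of a)"])
  qed
  let ?D = "mdeg ` Poly_Mapping.keys H"
  let ?S = "range (\<lambda>d. hom_part d H)"
  let ?U = "{a. a \<noteq> 0 \<and> (\<exists>F\<in>?S. peval (($) a) F \<noteq> 0)}"
  have expand: "peval (($) (s *s a)) H = (\<Sum>d\<in>?D. s ^ d * peval (($) a) (hom_part d H))" for s a
    by (subst (1) hom_part_decompose)
       (simp add: rhom.sum[OF rhom_peval] peval_scaled[OF homogeneous_hom_part])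
  have "zariski_open_proj ?U"
    unfolding zariski_open_proj_def by (intro exI[of _ ?S]) (auto intro: homogeneous_hom_part)
  moreover have "a0 \<in> ?U"
  proof -
    have "peval (($) a0) H \<noteq> 0" using F(1) by (simp add: H \<open>mat_of a0 = g0\<close>)
    then have "\<exists>d. peval (($) a0) (hom_part d H) \<noteq> 0"
      using expand[of 1 a0] by (metis (no_types, lifting) mult_zero_right sum.neutral vector_smult_lid)
    then show ?thesis using nonzero[of g0] F by (auto simp: a0_def)
  qed
  moreover have "Q a" if a: "a \<in> ?U" for a
  proof -
    obtain d where d: "peval (($) a) (hom_part d H) \<noteq> 0" using a by auto
    define p where "p = (\<Sum>d\<in>?D. monom (peval (($) a) (hom_part d H)) d)"
    have p: "poly p s = peval (($) (s *s a)) H" for s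
      by (simp add: expand p_def poly_sum poly_monom mult.commute)
    have "d \<in> ?D"
    proof (rule ccontr)
      assume "d \<notin> ?D"
      then have "hom_part d H = 0"
        by (intro poly_mapping_eqI) (auto simp: lookup_hom_part in_keys_iff)
      with d show False by (simp add: peval_zero)
    qed
    then have "coeff p d \<noteq> 0"
      using d by (simp add: p_def coeff_sum sum.delta')
    then have "p \<noteq> 0" by auto
    then obtain s where "poly p s \<noteq> 0" using exists_non_root[OF inf] by blast
    then have "peval (entries (mat_of (s *s a))) F \<noteq> 0" by (simp add: p H)
    from F(2)[OF this] nonzero[of "mat_of (s *s a)"] have "Q (s *s a)" "s *s a \<noteq> 0"
      by (auto simp: mat_of_point)
    then have "s \<noteq> 0" by auto
    then show "Q a" using \<open>Q (s *s a)\<close> by (rule inv)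
  qed
  ultimately show ?thesis unfolding for_general_point_def by blast
qed

text \<open>
  The actual dimension counts the monomials of degree \<open>t\<close> of the generic initial ideal that
  lie in the \<open>m\<close>-th power of the ideal of the first coordinate point.
\<close>

lemma adim_eq:
  fixes I :: "('v::{finite, linorder}, 'k::field) mpoly set"
  assumes inf: "infinite (UNIV :: 'k set)" and I: "graded_ideal I"
    and J: "generic_mat (\<lambda>g. lead_set (change_vars g ` I) = J)"
  shows "adim I t m = card {u \<in> J. mdeg u = t \<and> m \<le> tail_deg u}"
  unfolding adim_def
proof (rule the_equality)
  let ?Q = "\<lambda>d (a :: ('k, 'v) vec). kdim (component (I \<inter> ideal_power (point_ideal a) m) t) = d"
  show general: "for_general_point (?Q (card {u \<in> J. mdeg u = t \<and> m \<le> tail_deg u}))"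
  proof (rule for_general_pointI[OF inf])
    show "generic_mat (\<lambda>g. ?Q (card {u \<in> J. mdeg u = t \<and> m \<le> tail_deg u}) (g *v first_point))"
      using J by (rule generic_mat_mono) (simp add: kdim_fat_point[OF I])
  qed (simp add: point_ideal_scaled)
  show "d = card {u \<in> J. mdeg u = t \<and> m \<le> tail_deg u}" if "for_general_point (?Q d)" for d
    using for_general_point_common[OF inf that general] by auto
qed

section \<open>Counting monomials\<close>

lemma card_monomials:
  assumes "CARD('v::finite) = n + 1"
  shows "card {u :: 'v \<Rightarrow>\<^sub>0 nat. mdeg u = d} = (d + n) choose n"
proof -
  obtain xs :: "'v list" where xs: "set xs = UNIV" "distinct xs"
    using finite_distinct_list[of "UNIV :: 'v set"] by auto
  have len: "length xs = n + 1"
    using distinct_card[OF xs(2)] xs(1) assms by simp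
  have "bij_betw (\<lambda>u. map (Poly_Mapping.lookup u) xs) {u :: 'v \<Rightarrow>\<^sub>0 nat. mdeg u = d}
      {l. length l = n + 1 \<and> sum_list l = d}"
  proof (rule bij_betwI')
    show "map (Poly_Mapping.lookup u) xs = map (Poly_Mapping.lookup w) xs \<longleftrightarrow> u = w"
      for u w :: "'v \<Rightarrow>\<^sub>0 nat"
      using xs(1) by (auto intro: poly_mapping_eqI)
    have deg: "sum_list (map (Poly_Mapping.lookup u) xs) = mdeg u" for u :: "'v \<Rightarrow>\<^sub>0 nat"
      using xs by (simp add: mdeg_UNIV sum_list_distinct_conv_sum_set)
    show "map (Poly_Mapping.lookup u) xs \<in> {l. length l = n + 1 \<and> sum_list l = d}"
      if "u \<in> {u. mdeg u = d}" for u
      using that len by (simp add: deg)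
    show "\<exists>u\<in>{u. mdeg u = d}. l = map (Poly_Mapping.lookup u) xs"
      if l: "l \<in> {l. length l = n + 1 \<and> sum_list l = d}" for l
    proof -
      define u where "u = Abs_poly_mapping (\<lambda>v. the (map_of (zip xs l) v))"
      have "map (Poly_Mapping.lookup u) xs = l"
        using l len xs(2)
        by (intro nth_equalityI) (auto simp: u_def map_of_zip_nth)
      with l deg[of u] show ?thesis by (intro bexI[of _ u]) auto
    qed
  qed
  then have "card {u :: 'v \<Rightarrow>\<^sub>0 nat. mdeg u = d} = card {l :: nat list. length l = n + 1 \<and> sum_list l = d}"
    by (rule bij_betw_same_card)
  also have "\<dots> = (d + n) choose d" by (simp only: card_length_sum_list) simp
  also have "\<dots> = (d + n) choose n" using binomial_symmetric[of d "d + n"] by simp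
  finally show ?thesis .
qed

text \<open>
  Dividing by the power \<open>j + 1\<close> of the first variable matches the monomials of degree \<open>m + j\<close>
  outside the \<open>m\<close>-th power of the ideal of the first coordinate point with all monomials of
  degree \<open>m - 1\<close>. Their number is that of the conditions imposed by a point of
  multiplicity \<open>m\<close>.
\<close>

lemma card_monomials_tail_deg_less:
  assumes "CARD('v::{finite, linorder}) = n + 1" and "m \<ge> 1"
  shows "card {u :: 'v \<Rightarrow>\<^sub>0 nat. mdeg u = m + j \<and> tail_deg u < m} = (m + n - 1) choose n"
proof -
  let ?x = "Poly_Mapping.single first_var (Suc j) :: 'v \<Rightarrow>\<^sub>0 nat"
  have x: "tail_deg ?x = 0" by (simp add: tail_deg_def lookup_single)
  have "{u :: 'v \<Rightarrow>\<^sub>0 nat. mdeg u = m + j \<and> tail_deg u < m} = (\<lambda>w. w + ?x) ` {w. mdeg w = m - 1}"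
  proof (intro equalityI subsetI)
    fix u :: "'v \<Rightarrow>\<^sub>0 nat" assume u: "u \<in> {u. mdeg u = m + j \<and> tail_deg u < m}"
    then have "Suc j \<le> Poly_Mapping.lookup u first_var" by (simp add: mdeg_eq_tail_deg)
    then have "u = (u - ?x) + ?x"
      by (intro poly_mapping_eqI) (auto simp: lookup_add lookup_minus lookup_single when_def)
    moreover from this have "mdeg u = mdeg (u - ?x) + Suc j" by (metis mdeg_add mdeg_single)
    ultimately show "u \<in> (\<lambda>w. w + ?x) ` {w. mdeg w = m - 1}" using u by auto
  next
    fix u assume "u \<in> (\<lambda>w. w + ?x) ` {w. mdeg w = m - 1}"
    then obtain w where w: "u = w + ?x" "mdeg w = m - 1" by auto
    moreover have "tail_deg w \<le> mdeg w" by (simp add: mdeg_eq_tail_deg)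
    ultimately show "u \<in> {u. mdeg u = m + j \<and> tail_deg u < m}"
      using assms(2) by (simp add: mdeg_add tail_deg_add x)
  qed
  then have "card {u :: 'v \<Rightarrow>\<^sub>0 nat. mdeg u = m + j \<and> tail_deg u < m} =
      card {w :: 'v \<Rightarrow>\<^sub>0 nat. mdeg w = m - 1}"
    by (simp add: card_image)
  then show ?thesis using card_monomials[OF assms(1), of "m - 1"] assms(2) by simp
qed

section \<open>Lex-segments and unexpected hypersurfaces\<close>

text \<open>The set of monomials witnessing a lex-segment is determined by its span.\<close>

lemma lex_segment_upper:
  fixes M :: "('v::linorder \<Rightarrow>\<^sub>0 nat) set"
  assumes "lex_segment (supported M :: ('v, 'k::field) mpoly set)"
    and "\<And>w. w \<in> M \<Longrightarrow> mdeg w = t" "v \<in> M" "mdeg u = t" "v \<le> u"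
  shows "u \<in> M"
proof -
  obtain t' M' where M': "lex_segment_monomials t' M'"
      "(supported M :: ('v, 'k) mpoly set) = kspan (mono_poly ` M')"
    using assms(1) by (auto simp: lex_segment_def)
  then have "M' = M" by (simp add: kspan_monomials supported_inject)
  with M'(1) assms(2-5) show ?thesis
    unfolding lex_segment_monomials_def by metis
qed

text \<open>
  A leading monomial of tail degree at least \<open>m\<close> lies below every monomial of the same degree
  with tail degree less than \<open>m\<close>. So a lex-segment that contains one of the former
  contains all of the latter, and these account for exactly the expected number of conditions.
\<close>

lemma AV_eq_0:
  fixes I :: "('v::{finite, linorder}, 'k::field) mpoly set"
  assumes inf: "infinite (UNIV :: 'k set)" and n: "CARD('v) = n + 1" and I: "graded_ideal I"
    and m: "m \<ge> 1" and lex: "lex_segment (component (gin I) (m + j))" and pos: "adim I (m + j) m > 0"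
  shows "AV n I j m = 0"
proof -
  obtain J where J: "generic_mat (\<lambda>g. lead_set (change_vars g ` I) = J)"
    using generic_lead_set[OF inf I] by blast
  define M where "M = {u \<in> J. mdeg u = m + j}"
  have fin: "finite M" unfolding M_def by (rule finite_subset[OF _ finite_mdeg[of "m + j"]]) auto
  have "is_ideal I" using I by (simp add: graded_ideal_def)
  then have lexM: "lex_segment (supported M :: ('v, 'k) mpoly set)"
    using lex by (simp add: gin_eq[OF inf _ J] component_supported M_def)
  have dim: "kdim (component I (m + j)) = card M"
    using generic_mat_ex[OF J] card_lead_set_image[OF I, of _ "m + j"] by (auto simp: M_def)
  have adim: "adim I (m + j) m = card {u \<in> M. m \<le> tail_deg u}"
    by (simp add: adim_eq[OF inf I J] M_def conj_assoc)
  with pos obtain v where v: "v \<in> M" "m \<le> tail_deg v"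
    by (metis (mono_tags, lifting) card_gt_0_iff empty_Collect_eq)
  have sub: "{u. mdeg u = m + j \<and> tail_deg u < m} \<subseteq> M"
  proof clarify
    fix u :: "'v \<Rightarrow>\<^sub>0 nat" assume u: "mdeg u = m + j" "tail_deg u < m"
    have "mdeg v = m + j" using v(1) by (simp add: M_def)
    with u v(2) have "Poly_Mapping.lookup v first_var < Poly_Mapping.lookup u first_var"
      by (simp add: mdeg_eq_tail_deg)
    then have "v \<le> u" using lookup_first_var_mono[of u v] by (meson leD linear)
    then show "u \<in> M" using lex_segment_upper[OF lexM _ v(1) u(1)] by (simp add: M_def)
  qed
  have "M = {u \<in> M. m \<le> tail_deg u} \<union> {u. mdeg u = m + j \<and> tail_deg u < m}"
    using sub by (auto simp: M_def)
  moreover have "finite {u :: 'v \<Rightarrow>\<^sub>0 nat. mdeg u = m + j \<and> tail_deg u < m}"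
    using sub fin by (rule finite_subset)
  ultimately have "card M = card {u \<in> M. m \<le> tail_deg u} +
      card {u :: 'v \<Rightarrow>\<^sub>0 nat. mdeg u = m + j \<and> tail_deg u < m}"
    using fin by (metis (no_types, lifting) card_Un_disjoint disjoint_iff finite_Un leD mem_Collect_eq)
  then show ?thesis
    by (simp add: AV_def vdim_def adim dim card_monomials_tail_deg_less[OF n m])
qed

text \<open>A nonzero form of degree \<open>t\<close> has multiplicity at most \<open>t\<close> at every point.\<close>

lemma adim_eq_0:
  fixes I :: "('v::{finite, linorder}, 'k::field) mpoly set"
  assumes inf: "infinite (UNIV :: 'k set)" and I: "graded_ideal I" and "t < m"
  shows "adim I t m = 0"
proof -
  obtain J where J: "generic_mat (\<lambda>g. lead_set (change_vars g ` I) = J)"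
    using generic_lead_set[OF inf I] by blast
  have "{u \<in> J. mdeg u = t \<and> m \<le> tail_deg u} = {}"
    using assms(3) by (auto simp: mdeg_eq_tail_deg)
  then show ?thesis unfolding adim_eq[OF inf I J] by (simp only: card.empty)
qed

theorem proposition3p9:
  fixes I\<^sub>X :: "('v::{finite, linorder}, 'k::field) mpoly set" and n :: nat
  assumes "infinite (UNIV :: 'k set)"
    and "CARD('v) = n + 1"
    and "subscheme_ideal I\<^sub>X"
  shows "(\<forall>m \<ge> 1. \<forall>j.
            lex_segment (component (gin I\<^sub>X) (m + j)) \<and> adim I\<^sub>X (m + j) m > 0
              \<longrightarrow> AV n I\<^sub>X j m = 0)
       \<and> (lex_segment_ideal (gin I\<^sub>X) \<longrightarrow>
            (\<forall>t. \<forall>m \<ge> 1. \<not> admits_unexpected n I\<^sub>X t m))"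
proof -
  have I: "graded_ideal I\<^sub>X"
    using assms(3) by (intro homogeneous_ideal_graded) (simp add: subscheme_ideal_def)
  have first: "AV n I\<^sub>X j m = 0"
    if "m \<ge> 1" "lex_segment (component (gin I\<^sub>X) (m + j))" "adim I\<^sub>X (m + j) m > 0" for m j
    by (rule AV_eq_0[OF assms(1,2) I that])
  have second: "\<not> admits_unexpected n I\<^sub>X t m" if "lex_segment_ideal (gin I\<^sub>X)" "m \<ge> 1" for t m
  proof (cases "adim I\<^sub>X t m = 0")
    case True
    then show ?thesis by (simp add: admits_unexpected_def edim_def)
  next
    case False
    with adim_eq_0[OF assms(1) I] have "m \<le> t" by (meson not_le)
    then obtain j where t: "t = m + j" using le_Suc_ex by blast
    have "AV n I\<^sub>X j m = 0"
      using that False by (intro first) (auto simp: lex_segment_ideal_def t)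
    then show ?thesis by (simp add: admits_unexpected_def edim_def AV_def t)
  qed
  from first second show ?thesis by blast
qed

end
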